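(* Let $L>0$, let $0=\mathsf{v}_1<\mathsf{v}_2<\mathsf{v}_3<\dots$ be a strictly increasing sequence in $[0,L)$ with $\sum_{n=1}^{\infty}(\mathsf{v}_{n+1}-\mathsf{v}_n)=L$, and let $\sigma=(\sigma_n)_{n\in\mathbb{N}}\subset[0,\infty)$ with $(\sigma_n)_{n\in\mathbb{N}}\notin\ell^1(\mathbb{N})$. Let $\lambda_n(\sigma)$ and $\lambda_n(0)$, $n\in\mathbb{N}$, denote the eigenvalues of the operators $H_\sigma$ and $H_0$ (the latter corresponding to the zero sequence), respectively. Then $$\lim_{N\to\infty}\frac{1}{N}\sum_{n=1}^{N}\bigl(\lambda_n(\sigma)-\lambda_n(0)\bigr)=\infty .$$
   Context: Let $I=[0,L]$. For a sequence $\sigma=(\sigma_n)_{n\in\mathbb{N}}\subset[0,\infty)$, consider on $L^2(I)$ the quadratic form $h^{\sigma}[\varphi]=\int_I|\varphi'|^2\,\mathrm{d}x+\sum_{n=1}^{\infty}\sigma_n|\varphi(\mathsf{v}_n)|^2$ with form domain $\mathcal{D}_\sigma=\{\varphi\in H^1(I): h^\sigma[\varphi]<\infty\}$ (functions in $H^1(I)$ are identified with their continuous representatives). This form is densely defined, closed and non-negative, and $H_\sigma$ denotes the unique self-adjoint operator associated with it; informally $H_\sigma=-\frac{\mathrm{d}^2}{\mathrm{d}x^2}+\sum_{n=1}^\infty\sigma_n\delta(x-\mathsf{v}_n)$. The operator $H_\sigma$ has purely discrete spectrum, and its eigenvalues, counted with multiplicity, are written $0\le\lambda_1(\sigma)\le\lambda_2(\sigma)\le\dots$.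 For $\sigma=0$, $H_0$ is the Neumann Laplacian on $[0,L]$. *)

theory Defs
  imports "HOL-Analysis.Analysis" "HOL-Library.Function_Algebras"
begin

text \<open>Sequences are indexed from 0, so \<open>v n\<close>, \<open>\<sigma> n\<close> and \<open>delta_eigenvalue L v \<sigma> n\<close> stand for
  $v_{n+1}$, $\sigma_{n+1}$ and $\lambda_{n+1}(\sigma)$.\<close>

interpretation cfun: vector_space "\<lambda>(c::complex) (f::real \<Rightarrow> complex) x. c * f x"
  by unfold_locales (auto simp: fun_eq_iff algebra_simps)

text \<open>Elements of the following space are representatives of classes in $L^2([0,L])$;
  their values outside $[0,L]$ are irrelevant.\<close>

definition L2 :: "real \<Rightarrow> (real \<Rightarrow> complex) set" where
  "L2 L = {f. f \<in> borel_measurable (lebesgue_on {0..L}) \<and>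
              integrable (lebesgue_on {0..L}) (\<lambda>x. (cmod (f x))\<^sup>2)}"

definition L2_inner :: "real \<Rightarrow> (real \<Rightarrow> complex) \<Rightarrow> (real \<Rightarrow> complex) \<Rightarrow> complex" where
  "L2_inner L f g = (LINT x|lebesgue_on {0..L}. f x * cnj (g x))"

text \<open>\<open>is_H1_deriv L \<phi> g\<close>: on $[0,L]$ the function \<open>\<phi>\<close> is absolutely continuous with
  derivative \<open>g\<close> in $L^2$, i.e. \<open>\<phi>\<close> is the continuous representative of an element of
  $H^1([0,L])$ with weak derivative \<open>g\<close>.\<close>

definition is_H1_deriv :: "real \<Rightarrow> (real \<Rightarrow> complex) \<Rightarrow> (real \<Rightarrow> complex) \<Rightarrow> bool" where
  "is_H1_deriv L \<phi> g \<longleftrightarrow>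
     g \<in> L2 L \<and> (\<forall>x\<in>{0..L}. \<phi> x = \<phi> 0 + (LINT t|lebesgue_on {0..x}. g t))"

text \<open>Functions in \<open>H1\<close> are extended by 0 outside $[0,L]$, so that distinct functions are
  distinct elements of $H^1([0,L])$ and dimensions of subspaces are the correct ones.\<close>

definition H1 :: "real \<Rightarrow> (real \<Rightarrow> complex) set" where
  "H1 L = {\<phi>. (\<forall>x. x \<notin> {0..L} \<longrightarrow> \<phi> x = 0) \<and> (\<exists>g. is_H1_deriv L \<phi> g)}"

text \<open>The choice below is unique up to null sets.\<close>

definition H1_deriv :: "real \<Rightarrow> (real \<Rightarrow> complex) \<Rightarrow> (real \<Rightarrow> complex)" where
  "H1_deriv L \<phi> = (SOME g. is_H1_deriv L \<phi> g)"

text \<open>The domain consists of the $H^1$ functions with $h^\sigma[\varphi] < \infty$.\<close>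

definition form_domain :: "real \<Rightarrow> (nat \<Rightarrow> real) \<Rightarrow> (nat \<Rightarrow> real) \<Rightarrow> (real \<Rightarrow> complex) set" where
  "form_domain L v \<sigma> = {\<phi> \<in> H1 L. summable (\<lambda>n. \<sigma> n * (cmod (\<phi> (v n)))\<^sup>2)}"

text \<open>The sesquilinear form whose quadratic form \<open>delta_form L v \<sigma> \<phi> \<phi>\<close> is $h^\sigma[\varphi]$.\<close>

definition delta_form ::
  "real \<Rightarrow> (nat \<Rightarrow> real) \<Rightarrow> (nat \<Rightarrow> real) \<Rightarrow> (real \<Rightarrow> complex) \<Rightarrow> (real \<Rightarrow> complex) \<Rightarrow> complex" where
  "delta_form L v \<sigma> \<phi> \<psi> =
     L2_inner L (H1_deriv L \<phi>) (H1_deriv L \<psi>)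
     + (\<Sum>n. of_real (\<sigma> n) * \<phi> (v n) * cnj (\<psi> (v n)))"

text \<open>The graph of the self-adjoint operator associated with the form (first representation
  theorem): \<open>delta_op L v \<sigma> \<phi> f\<close> means that \<open>\<phi>\<close> is in the operator domain of $H_\sigma$ and
  $H_\sigma\varphi = f$ in $L^2([0,L])$.\<close>

definition delta_op ::
  "real \<Rightarrow> (nat \<Rightarrow> real) \<Rightarrow> (nat \<Rightarrow> real) \<Rightarrow> (real \<Rightarrow> complex) \<Rightarrow> (real \<Rightarrow> complex) \<Rightarrow> bool" where
  "delta_op L v \<sigma> \<phi> f \<longleftrightarrow>
     \<phi> \<in> form_domain L v \<sigma> \<and> f \<in> L2 L \<and>
     (\<forall>\<psi>\<in>form_domain L v \<sigma>. delta_form L v \<sigma> \<phi> \<psi> = L2_inner L f \<psi>)"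

definition eigenspace ::
  "real \<Rightarrow> (nat \<Rightarrow> real) \<Rightarrow> (nat \<Rightarrow> real) \<Rightarrow> real \<Rightarrow> (real \<Rightarrow> complex) set" where
  "eigenspace L v \<sigma> \<mu> = {\<phi>. delta_op L v \<sigma> \<phi> (\<lambda>x. of_real \<mu> * \<phi> x)}"

text \<open>\<open>lam\<close> lists all eigenvalues in non-decreasing order, each one repeated according to its
  (finite) multiplicity; \<open>\<mu>\<close> is not an eigenvalue iff the eigenspace has dimension 0. The
  finiteness conditions are explicit because \<open>card\<close> and \<open>cfun.dim\<close> are 0 in infinite cases.\<close>

definition eigenvalue_enumeration ::
  "real \<Rightarrow> (nat \<Rightarrow> real) \<Rightarrow> (nat \<Rightarrow> real) \<Rightarrow> (nat \<Rightarrow> real) \<Rightarrow> bool" where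
  "eigenvalue_enumeration L v \<sigma> lam \<longleftrightarrow>
     mono lam \<and>
     (\<forall>\<mu>. finite {n. lam n = \<mu>} \<and>
          (\<exists>B. finite B \<and> eigenspace L v \<sigma> \<mu> = cfun.span B) \<and>
          cfun.dim (eigenspace L v \<sigma> \<mu>) = card {n. lam n = \<mu>})"

definition delta_eigenvalue :: "real \<Rightarrow> (nat \<Rightarrow> real) \<Rightarrow> (nat \<Rightarrow> real) \<Rightarrow> nat \<Rightarrow> real" where
  "delta_eigenvalue L v \<sigma> = (THE lam. eigenvalue_enumeration L v \<sigma> lam)"

end

theory Submission
  imports Defs "HOL-Complex_Analysis.Great_Picard"
begin

text \<open>
  The non-summable point interactions act as a Dirichlet condition at the right end point, and this
  changes the spectrum at leading order. Since \<open>v n\<close> tends to \<open>L\<close>, a continuous function with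
  \<open>\<phi> L \<noteq> 0\<close> has infinite energy (\<open>nonsummable_imp_Dirichlet\<close>). So every function in the form domain
  of $H_\sigma$ vanishes at \<open>L\<close>, and $H_\sigma$ lies above the Laplacian with a Neumann condition at 0 and
  a Dirichlet condition at \<open>L\<close>. Counting \<open>n\<close> from 0, this means
  \[ \lambda_n(\sigma) \ge \Bigl(\frac{(n + 1/2)\,\pi}{L}\Bigr)^2 , \qquad
     \lambda_n(0) \le \Bigl(\frac{n\,\pi}{L}\Bigr)^2 , \]
  so that the difference is at least $n\,\pi^2/L^2$. It tends to infinity, and its arithmetic means do
  the same.

  The upper bound (\<open>Neumann_eigenvalue_le\<close>) holds because the cosines \<open>cos (k * pi * x / L)\<close> are
  eigenfunctions of $H_0$ with distinct eigenvalues. For the lower bound (\<open>nonsummable_eigenvalue_ge\<close>),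
  some nonzero combination \<open>\<phi>\<close> of the first \<open>n + 1\<close> eigenfunctions of $H_\sigma$ vanishes at the \<open>n\<close>
  interior zeros of \<open>cos ((n + 1 / 2) * pi * x / L)\<close>. Its energy is at most
  $\lambda_n(\sigma) \|\varphi\|^2$. As \<open>\<phi>\<close> also vanishes at \<open>L\<close>, Wirtinger's inequality on each
  of the intervals between these zeros (\<open>Wirtinger_equidistant_zeros\<close>) bounds the energy from below.

  These arguments speak about the eigenvalues only if \<open>delta_eigenvalue\<close> denotes an enumeration of
  the spectrum, so most of the work is to show that such an enumeration exists and is unique. Eigenfunctions
  are obtained by successive minimization of the Rayleigh quotient (\<open>exists_eigenbasis\<close>). The minima are
  attained because the form domain is complete for the form norm, by the Riesz-Fischer theorem
  \<open>sq_integrable_complete\<close>, and compactly embedded in $L^2$, by the Arzela-Ascoli theorem. Uniqueness is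
  \<open>mono_sequence_determined_by_multiplicities\<close>.\<close>

section \<open>Homogeneous linear systems\<close>

text \<open>The only piece of linear algebra behind the variational arguments below: prescribing fewer
linear conditions than there are free coefficients leaves a nonzero combination. Index sets
are arbitrary, so that Gaussian elimination can remove any equation and any unknown.\<close>
lemma homogeneous_system_nontrivial_solution:
  fixes A :: "'j \<Rightarrow> 'i \<Rightarrow> 'k::field"
  assumes "finite J" "finite I" "card J < card I"
  obtains c where "\<exists>i\<in>I. c i \<noteq> 0" "\<And>j. j \<in> J \<Longrightarrow> (\<Sum>i\<in>I. A j i * c i) = 0"
proof -
  have "\<exists>c. (\<exists>i\<in>I. c i \<noteq> 0) \<and> (\<forall>j\<in>J. (\<Sum>i\<in>I. A j i * c i) = 0)"
    using assms
  proof (induction J arbitrary: I A rule: finite_induct)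
    case empty
    then have "I \<noteq> {}" by auto
    then show ?case by (intro exI[of _ "\<lambda>_. 1"]) auto
  next
    case (insert j J)
    show ?case
    proof (cases "\<forall>i\<in>I. A j i = 0")
      case True
      have "card J < card I" using insert by auto
      from insert.IH[OF insert.prems(1) this, of A] obtain c
        where "(\<exists>i\<in>I. c i \<noteq> 0) \<and> (\<forall>j\<in>J. (\<Sum>i\<in>I. A j i * c i) = 0)" by blast
      with True show ?thesis by (intro exI[of _ c]) simp
    next
      case False
      then obtain p where p: "p \<in> I" "A j p \<noteq> 0" by auto
      \<comment> \<open>eliminate the unknown \<open>p\<close> with the help of equation \<open>j\<close>\<close>
      define A' where "A' k i = A k i - A k p * A j i / A j p" for k i
      have "card J < card (I - {p})" using insert p by (simp add: card_Diff_singleton)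
      with insert.IH[of "I - {p}" A'] insert.prems obtain c
        where c: "\<exists>i\<in>I - {p}. c i \<noteq> 0"
          and eq: "\<And>k. k \<in> J \<Longrightarrow> (\<Sum>i\<in>I - {p}. A' k i * c i) = 0"
        by (metis finite_Diff)
      define S where "S k = (\<Sum>i\<in>I - {p}. A k i * c i)" for k
      define d where "d i = (if i = p then - S j / A j p else c i)" for i
      have sum_d: "(\<Sum>i\<in>I. A k i * d i) = S k - A k p * S j / A j p" for k
      proof -
        have "(\<Sum>i\<in>I. A k i * d i) = A k p * d p + (\<Sum>i\<in>I - {p}. A k i * d i)"
          using p insert.prems by (simp add: sum.remove)
        also have "(\<Sum>i\<in>I - {p}. A k i * d i) = S k"
          unfolding S_def by (rule sum.cong) (auto simp: d_def)
        finally show ?thesis by (simp add: d_def)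
      qed
      have "(\<Sum>i\<in>I. A k i * d i) = 0" if "k \<in> insert j J" for k
      proof (cases "k = j")
        case True
        then show ?thesis using p by (simp add: sum_d)
      next
        case False
        with that have "k \<in> J" by simp
        have "(\<Sum>i\<in>I - {p}. A' k i * c i) = S k - A k p * S j / A j p"
          unfolding A'_def S_def
          by (simp add: algebra_simps sum_subtractf sum_distrib_left sum_divide_distrib)
        then show ?thesis using eq[OF \<open>k \<in> J\<close>] by (simp add: sum_d)
      qed
      moreover have "\<exists>i\<in>I. d i \<noteq> 0" using c by (auto simp: d_def)
      ultimately show ?thesis by blast
    qed
  qed
  then show ?thesis using that by blast
qed

section \<open>Positive semi-definite hermitian forms\<close>

text \<open>Both the $L^2$ inner product and the form $h^\sigma$ are instances of the following locale, and so
is the difference of $h^\sigma$ and a multiple of the inner product on a subspace where it is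
non-negative. That last use is the reason why the form lives on a subset of the ambient space
and is only semi-definite.\<close>
locale hermitian_form = vector_space scale
  for scale :: "complex \<Rightarrow> 'a::ab_group_add \<Rightarrow> 'a" (infixr \<open>*s\<close> 75) +
  fixes V :: "'a set" and s :: "'a \<Rightarrow> 'a \<Rightarrow> complex"
  assumes subspace_V: "subspace V"
    and add_left: "\<And>x y z. x \<in> V \<Longrightarrow> y \<in> V \<Longrightarrow> z \<in> V \<Longrightarrow> s (x + y) z = s x z + s y z"
    and scale_left: "\<And>c x z. x \<in> V \<Longrightarrow> z \<in> V \<Longrightarrow> s (c *s x) z = c * s x z"
    and hermitian: "\<And>x y. x \<in> V \<Longrightarrow> y \<in> V \<Longrightarrow> s y x = cnj (s x y)"
    and nonneg: "\<And>x. x \<in> V \<Longrightarrow> 0 \<le> Re (s x x)"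
begin

definition Q :: "'a \<Rightarrow> real" where "Q x = Re (s x x)"

lemma V_intros [simp, intro]:
  "0 \<in> V" "x \<in> V \<Longrightarrow> y \<in> V \<Longrightarrow> x + y \<in> V" "x \<in> V \<Longrightarrow> y \<in> V \<Longrightarrow> x - y \<in> V"
  "x \<in> V \<Longrightarrow> c *s x \<in> V" "(\<And>i. i \<in> A \<Longrightarrow> f i \<in> V) \<Longrightarrow> sum f A \<in> V"
  using subspace_V by (auto intro: subspace_0 subspace_add subspace_diff subspace_scale subspace_sum)

lemma Q_nonneg: "x \<in> V \<Longrightarrow> 0 \<le> Q x"
  by (simp add: Q_def nonneg)

lemma diagonal: "x \<in> V \<Longrightarrow> s x x = of_real (Q x)"
  using hermitian[of x x] by (auto simp: Q_def complex_eq_iff)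

lemma add_right: "x \<in> V \<Longrightarrow> y \<in> V \<Longrightarrow> z \<in> V \<Longrightarrow> s x (y + z) = s x y + s x z"
  by (metis V_intros(2) add_left complex_cnj_add hermitian)

lemma scale_right: "x \<in> V \<Longrightarrow> y \<in> V \<Longrightarrow> s x (c *s y) = cnj c * s x y"
  by (metis V_intros(4) complex_cnj_mult hermitian scale_left)

lemma diff_left: "x \<in> V \<Longrightarrow> y \<in> V \<Longrightarrow> z \<in> V \<Longrightarrow> s (x - y) z = s x z - s y z"
  by (metis V_intros(3) add_left add_diff_cancel diff_add_cancel)

lemma diff_right: "x \<in> V \<Longrightarrow> y \<in> V \<Longrightarrow> z \<in> V \<Longrightarrow> s x (y - z) = s x y - s x z"
  by (metis V_intros(3) add_right add_diff_cancel diff_add_cancel)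

lemma zero_left: "x \<in> V \<Longrightarrow> s 0 x = 0"
  using diff_left[of 0 0 x] by simp

lemma zero_right: "x \<in> V \<Longrightarrow> s x 0 = 0"
  using diff_right[of x 0 0] by simp

lemma sum_left:
  assumes "\<And>i. i \<in> A \<Longrightarrow> f i \<in> V" "y \<in> V"
  shows "s (\<Sum>i\<in>A. c i *s f i) y = (\<Sum>i\<in>A. c i * s (f i) y)"
  using assms by (induction A rule: infinite_finite_induct) (auto simp: zero_left add_left scale_left)

lemma sum_right:
  assumes "\<And>i. i \<in> A \<Longrightarrow> f i \<in> V" "y \<in> V"
  shows "s y (\<Sum>i\<in>A. c i *s f i) = (\<Sum>i\<in>A. cnj (c i) * s y (f i))"
  using assms by (induction A rule: infinite_finite_induct) (auto simp: zero_right add_right scale_right)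

lemma Q_add: "x \<in> V \<Longrightarrow> y \<in> V \<Longrightarrow> Q (x + y) = Q x + Q y + 2 * Re (s x y)"
  using hermitian[of x y] by (simp add: Q_def add_left add_right)

text \<open>Solved for the difference, because this is how minimizing sequences are shown to be Cauchy:
an upper bound for \<open>Q x\<close> and \<open>Q y\<close> and a lower bound for \<open>Q (x + y)\<close> make \<open>Q (x - y)\<close> small.\<close>
lemma Q_parallelogram: "x \<in> V \<Longrightarrow> y \<in> V \<Longrightarrow> Q (x - y) = 2 * Q x + 2 * Q y - Q (x + y)"
  using hermitian[of x y] by (simp add: Q_def add_left add_right diff_left diff_right)

lemma Q_scale: "x \<in> V \<Longrightarrow> Q (c *s x) = (cmod c)\<^sup>2 * Q x"
  using diagonal[of x] by (simp add: Q_def scale_left scale_right mult.assoc[symmetric])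
    (simp add: cmod_power2 flip: power2_eq_square)

lemma Q_diff_scale:
  "x \<in> V \<Longrightarrow> y \<in> V \<Longrightarrow> Q (x - c *s y) = Q x + (cmod c)\<^sup>2 * Q y - 2 * Re (cnj c * s x y)"
  using hermitian[of x y] Q_scale[of y c]
  by (simp add: Q_def diff_left diff_right scale_left scale_right algebra_simps)

text \<open>With \<open>z = s x y\<close>, expand \<open>0 \<le> Q (x - (t * z) *s y)\<close> for real \<open>t\<close>. If \<open>Q y > 0\<close> the optimal \<open>t\<close> gives
the claim; if \<open>Q y = 0\<close> the expression is affine in \<open>t\<close>, which forces \<open>z = 0\<close>.\<close>
lemma Cauchy_Schwarz:
  assumes "x \<in> V" "y \<in> V"
  shows "(cmod (s x y))\<^sup>2 \<le> Q x * Q y"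
proof -
  define z where "z = s x y"
  have zz: "Re (cnj z * z) = (cmod z)\<^sup>2"
    by (simp add: cmod_power2 flip: power2_eq_square)
  have *: "0 \<le> Q x + (t * cmod z)\<^sup>2 * Q y - 2 * t * (cmod z)\<^sup>2" for t :: real
  proof -
    have "0 \<le> Q (x - (of_real t * z) *s y)"
      using assms by (intro Q_nonneg) auto
    also have "\<dots> = Q x + (t * cmod z)\<^sup>2 * Q y - 2 * Re (of_real t * (cnj z * z))"
      using assms by (simp add: Q_diff_scale norm_mult power_mult_distrib z_def mult.assoc)
    also have "Re (of_real t * (cnj z * z)) = t * Re (cnj z * z)"
      by simp
    finally show ?thesis unfolding zz by simp
  qed
  show ?thesis
  proof (cases "Q y = 0")
    case False
    then have pos: "Q y > 0" using Q_nonneg[OF assms(2)] by simp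
    from *[of "1 / Q y"] have "0 \<le> Q x - (cmod z)\<^sup>2 / Q y"
      using pos by (simp add: power2_eq_square field_simps)
    then show ?thesis using pos by (simp add: field_simps z_def)
  next
    case True
    have "(cmod z)\<^sup>2 = 0"
    proof (rule ccontr)
      assume "(cmod z)\<^sup>2 \<noteq> 0"
      then have "(cmod z)\<^sup>2 > 0" by simp
      then show False using *[of "(Q x + 1) / (2 * (cmod z)\<^sup>2)"] True by simp
    qed
    then show ?thesis using True by (simp add: z_def)
  qed
qed

lemma tendsto_left:
  assumes "\<And>n. X n \<in> V" "x \<in> V" "y \<in> V" "(\<lambda>n. Q (X n - x)) \<longlonglongrightarrow> 0"
  shows "(\<lambda>n. s (X n) y) \<longlonglongrightarrow> s x y"
proof -
  have "(\<lambda>n. (cmod (s (X n - x) y))\<^sup>2) \<longlonglongrightarrow> 0"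
  proof (rule tendsto_sandwich[OF _ _ tendsto_const])
    show "\<forall>\<^sub>F n in sequentially. (cmod (s (X n - x) y))\<^sup>2 \<le> Q (X n - x) * Q y"
      using assms by (intro always_eventually allI Cauchy_Schwarz) auto
    show "(\<lambda>n. Q (X n - x) * Q y) \<longlonglongrightarrow> 0"
      using tendsto_mult[OF assms(4) tendsto_const[of "Q y"]] by simp
  qed auto
  then have "(\<lambda>n. sqrt ((cmod (s (X n - x) y))\<^sup>2)) \<longlonglongrightarrow> sqrt 0"
    by (rule tendsto_real_sqrt)
  then have "(\<lambda>n. s (X n - x) y) \<longlonglongrightarrow> 0"
    by (simp add: tendsto_norm_zero_iff)
  then have "(\<lambda>n. s (X n) y - s x y) \<longlonglongrightarrow> 0"
    using assms by (simp add: diff_left)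
  then show ?thesis by (simp add: LIM_zero_iff)
qed

lemma tendsto_Q:
  assumes "\<And>n. X n \<in> V" "x \<in> V" "(\<lambda>n. Q (X n - x)) \<longlonglongrightarrow> 0"
  shows "(\<lambda>n. Q (X n)) \<longlonglongrightarrow> Q x"
proof -
  have eq: "Q (X n) = Q (X n - x) - Q x + 2 * Re (s (X n) x)" for n
    using Q_add[of "X n - x" x] assms by (simp add: diff_left) (simp add: Q_def)
  have "(\<lambda>n. Q (X n - x) - Q x + 2 * Re (s (X n) x)) \<longlonglongrightarrow> 0 - Q x + 2 * Re (s x x)"
    using assms by (intro tendsto_intros tendsto_left) auto
  then have "(\<lambda>n. Q (X n)) \<longlonglongrightarrow> 0 - Q x + 2 * Re (s x x)" by (simp only: eq[symmetric])
  then show ?thesis by (simp add: Q_def)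
qed

end

section \<open>Spectral theory of closed forms with compact embedding\<close>

text \<open>The two analytic inputs for a discrete spectrum, in terms of sequences: \<open>compact\<close> says that the
form domain embeds compactly into the Hilbert space, \<open>complete\<close> that the form is closed. The
assumption \<open>orthogonal_sequence\<close> makes the form domain infinite-dimensional, hence the sequence of
eigenvalues infinite.\<close>
locale discrete_form =
  ip: hermitian_form scale V ip + h: hermitian_form scale V h
  for scale :: "complex \<Rightarrow> 'a::ab_group_add \<Rightarrow> 'a" (infixr \<open>*s\<close> 75) and V ip h +
  assumes definite: "\<And>x. x \<in> V \<Longrightarrow> ip.Q x = 0 \<Longrightarrow> x = 0"
    and compact: "\<And>X B. (\<And>n. X n \<in> V) \<Longrightarrow> (\<And>n. ip.Q (X n) \<le> B) \<Longrightarrow> (\<And>n. h.Q (X n) \<le> B) \<Longrightarrow>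
        \<exists>r::nat\<Rightarrow>nat. strict_mono r \<and>
          (\<forall>\<epsilon>>0. \<exists>M. \<forall>i\<ge>M. \<forall>j\<ge>M. ip.Q (X (r i) - X (r j)) < \<epsilon>)"
    and complete: "\<And>X. (\<And>n::nat. X n \<in> V) \<Longrightarrow>
        (\<And>\<epsilon>. \<epsilon> > 0 \<Longrightarrow> \<exists>M. \<forall>i\<ge>M. \<forall>j\<ge>M. ip.Q (X i - X j) < \<epsilon> \<and> h.Q (X i - X j) < \<epsilon>) \<Longrightarrow>
        \<exists>x\<in>V. (\<lambda>n. ip.Q (X n - x)) \<longlonglongrightarrow> 0 \<and> (\<lambda>n. h.Q (X n - x)) \<longlonglongrightarrow> 0"
    and orthogonal_sequence: "\<exists>b::nat\<Rightarrow>'a. (\<forall>n. b n \<in> V \<and> b n \<noteq> 0) \<and> (\<forall>m n. m \<noteq> n \<longrightarrow> ip (b m) (b n) = 0)"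
begin

text \<open>The eigenspaces of the operator associated with \<open>h\<close>, in weak form.\<close>
definition eigen :: "real \<Rightarrow> 'a set" where
  "eigen \<mu> = {x \<in> V. \<forall>y\<in>V. h x y = of_real \<mu> * ip x y}"

lemma Q_pos: "x \<in> V \<Longrightarrow> x \<noteq> 0 \<Longrightarrow> 0 < ip.Q x"
  using definite ip.Q_nonneg by force

lemma exists_orthogonal:
  assumes "\<And>i. i < n \<Longrightarrow> u i \<in> V"
  obtains x where "x \<in> V" "x \<noteq> 0" "\<And>i. i < (n::nat) \<Longrightarrow> ip x (u i) = 0"
proof -
  obtain b where b: "\<And>n::nat. b n \<in> V" "\<And>n. b n \<noteq> 0" "\<And>m n. m \<noteq> n \<Longrightarrow> ip (b m) (b n) = 0"
    using orthogonal_sequence by blast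
  obtain c where c: "\<exists>i\<in>{..n}. c i \<noteq> 0" "\<And>j. j \<in> {..<n} \<Longrightarrow> (\<Sum>i\<le>n. ip (b i) (u j) * c i) = 0"
    by (rule homogeneous_system_nontrivial_solution[of "{..<n}" "{..n}" "\<lambda>j i. ip (b i) (u j)"]) auto
  define x where "x = (\<Sum>i\<le>n. c i *s b i)"
  have xV: "x \<in> V" unfolding x_def using b by auto
  obtain k where k: "k \<le> n" "c k \<noteq> 0" using c by auto
  have "ip x (b k) = (\<Sum>i\<le>n. c i * ip (b i) (b k))"
    unfolding x_def using b by (intro ip.sum_left) auto
  also have "\<dots> = (\<Sum>i\<le>n. if i = k then c k * ip (b k) (b k) else 0)"
    using b by (intro sum.cong) auto
  also have "\<dots> = c k * ip (b k) (b k)" using k by simp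
  also have "\<dots> \<noteq> 0" using k b Q_pos[of "b k"] ip.diagonal[of "b k"] by auto
  finally have "x \<noteq> 0" using ip.zero_left b by auto
  moreover have "ip x (u j) = 0" if "j < n" for j
  proof -
    have "ip x (u j) = (\<Sum>i\<le>n. c i * ip (b i) (u j))"
      unfolding x_def using b assms that by (intro ip.sum_left) auto
    then show ?thesis using c(2)[of j] that by (simp add: mult.commute)
  qed
  ultimately show ?thesis using that xV by blast
qed

text \<open>The direct method. A minimizing sequence for the Rayleigh quotient on the orthogonal complement of
\<open>u 0, \<dots>, u (n - 1)\<close> has a subsequence that is Cauchy for the inner product, by compactness. The
parallelogram identity upgrades this to the form norm, since midpoints cannot have energy below the
infimum. The limit, which exists because the form is closed, is a minimizer.\<close>
lemma exists_minimizer: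
  assumes u: "\<And>i. i < n \<Longrightarrow> u i \<in> V"
  obtains y where "y \<in> V" "ip.Q y = 1" "\<And>i. i < (n::nat) \<Longrightarrow> ip y (u i) = 0"
    "\<And>x. x \<in> V \<Longrightarrow> (\<And>i. i < n \<Longrightarrow> ip x (u i) = 0) \<Longrightarrow> h.Q y * ip.Q x \<le> h.Q x"
proof -
  define W where "W = {x \<in> V. \<forall>i<n. ip x (u i) = 0}"
  have WV: "x \<in> V" if "x \<in> W" for x using that by (simp add: W_def)
  have W_add: "x + y \<in> W" if "x \<in> W" "y \<in> W" for x y
    using that u by (auto simp: W_def ip.add_left)
  have W_scale: "c *s x \<in> W" if "x \<in> W" for c x
    using that u by (auto simp: W_def ip.scale_left)
  define S where "S = h.Q ` {x \<in> W. ip.Q x = 1}"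
  define l where "l = Inf S"
  have bdd: "bdd_below S"
    unfolding S_def by (intro bdd_belowI[of _ 0]) (auto intro: h.Q_nonneg WV)
  obtain x0 where x0: "x0 \<in> W" "x0 \<noteq> 0"
    by (rule exists_orthogonal[of n u]) (use u in \<open>auto simp: W_def\<close>)
  have normalize: "\<exists>c. ip.Q (c *s x) = 1 \<and> h.Q (c *s x) = h.Q x / ip.Q x" if "x \<in> W" "x \<noteq> 0" for x
  proof -
    have pos: "ip.Q x > 0" using that Q_pos WV by auto
    show ?thesis
      using pos that WV
      by (intro exI[of _ "of_real (1 / sqrt (ip.Q x))"])
         (simp add: ip.Q_scale h.Q_scale norm_divide power_divide)
  qed
  have "S \<noteq> {}" using normalize[OF x0] W_scale[OF x0(1)] unfolding S_def by blast
  have lower: "l * ip.Q x \<le> h.Q x" if "x \<in> W" for x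
  proof (cases "x = 0")
    case True
    then show ?thesis by (simp add: ip.Q_def h.Q_def ip.zero_left h.zero_left)
  next
    case False
    then have pos: "ip.Q x > 0" using that Q_pos WV by auto
    obtain c where "ip.Q (c *s x) = 1" "h.Q (c *s x) = h.Q x / ip.Q x"
      using normalize[OF \<open>x \<in> W\<close> False] by blast
    then have "h.Q x / ip.Q x \<in> S" using W_scale[OF \<open>x \<in> W\<close>, of c]
      unfolding S_def by (metis (mono_tags, lifting) image_eqI mem_Collect_eq)
    then have "l \<le> h.Q x / ip.Q x" unfolding l_def using bdd by (rule cInf_lower)
    then show ?thesis using pos by (simp add: field_simps)
  qed
  have "\<exists>x. x \<in> W \<and> ip.Q x = 1 \<and> h.Q x < l + 1 / (real k + 1)" for k
  proof -
    have "Inf S < l + 1 / (real k + 1)" by (simp add: l_def)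
    then obtain z where "z \<in> S" "z < l + 1 / (real k + 1)"
      using \<open>S \<noteq> {}\<close> bdd by (auto simp: cInf_less_iff)
    then show ?thesis unfolding S_def by auto
  qed
  then obtain X where X: "\<And>k. X k \<in> W" "\<And>k. ip.Q (X k) = 1" "\<And>k. h.Q (X k) < l + 1 / (real k + 1)"
    by metis
  have Xb: "h.Q (X k) \<le> max 1 (l + 1)" for k
  proof -
    have "1 / (real k + 1) \<le> 1" by simp
    then show ?thesis using X(3)[of k] by linarith
  qed
  obtain r :: "nat \<Rightarrow> nat" where r: "strict_mono r"
    and rc: "\<And>\<epsilon>. \<epsilon> > 0 \<Longrightarrow> \<exists>M. \<forall>i\<ge>M. \<forall>j\<ge>M. ip.Q (X (r i) - X (r j)) < \<epsilon>"
  proof -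
    have "\<exists>r::nat \<Rightarrow> nat. strict_mono r \<and>
        (\<forall>\<epsilon>>0. \<exists>M. \<forall>i\<ge>M. \<forall>j\<ge>M. ip.Q (X (r i) - X (r j)) < \<epsilon>)"
      by (rule compact[of X "max 1 (l + 1)"]) (use X WV Xb in auto)
    then show ?thesis using that by blast
  qed
  define Y where "Y = X \<circ> r"
  have Y: "Y k \<in> W" "Y k \<in> V" "ip.Q (Y k) = 1" for k
    using X WV by (auto simp: Y_def)
  have Yh: "h.Q (Y k) < l + 1 / (real k + 1)" for k
  proof -
    have "h.Q (Y k) < l + 1 / (real (r k) + 1)" using X(3) by (simp add: Y_def)
    also have "1 / (real (r k) + 1) \<le> 1 / (real k + 1)"
      using seq_suble[OF r, of k] by (intro divide_left_mono) auto
    finally show ?thesis by simp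
  qed
  \<comment> \<open>parallelogram identity, with \<open>lower\<close> applied to \<open>Y i + Y j\<close>, which lies in \<open>W\<close> again\<close>
  have hdiff: "h.Q (Y i - Y j) \<le> 2 / (real i + 1) + 2 / (real j + 1) + \<bar>l\<bar> * ip.Q (Y i - Y j)" for i j
  proof -
    have "h.Q (Y i - Y j) = 2 * h.Q (Y i) + 2 * h.Q (Y j) - h.Q (Y i + Y j)"
      using Y by (intro h.Q_parallelogram) auto
    also have "\<dots> \<le> 2 * (l + 1 / (real i + 1)) + 2 * (l + 1 / (real j + 1)) - l * ip.Q (Y i + Y j)"
      using Yh[of i] Yh[of j] lower[OF W_add[OF Y(1) Y(1)], of i j]
      by (intro diff_mono add_mono mult_left_mono) auto
    also have "ip.Q (Y i + Y j) = 4 - ip.Q (Y i - Y j)"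
      using ip.Q_parallelogram[of "Y i" "Y j"] Y by simp
    also have "2 * (l + 1 / (real i + 1)) + 2 * (l + 1 / (real j + 1)) - l * (4 - ip.Q (Y i - Y j))
       = 2 / (real i + 1) + 2 / (real j + 1) + l * ip.Q (Y i - Y j)"
      by (simp add: algebra_simps)
    also have "l * ip.Q (Y i - Y j) \<le> \<bar>l\<bar> * ip.Q (Y i - Y j)"
      using Y by (intro mult_right_mono ip.Q_nonneg) auto
    finally show ?thesis by simp
  qed
  have "\<exists>M. \<forall>i\<ge>M. \<forall>j\<ge>M. ip.Q (Y i - Y j) < \<epsilon> \<and> h.Q (Y i - Y j) < \<epsilon>" if "\<epsilon> > 0" for \<epsilon>
  proof -
    define d where "d = min \<epsilon> (\<epsilon> / (3 * (\<bar>l\<bar> + 1)))"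
    have d: "d > 0" using that by (simp add: d_def)
    obtain M1 where M1: "\<And>i j. i \<ge> M1 \<Longrightarrow> j \<ge> M1 \<Longrightarrow> ip.Q (Y i - Y j) < d"
      using rc[OF d] by (auto simp: Y_def)
    obtain M2 :: nat where M2: "6 / \<epsilon> < real M2" using reals_Archimedean2 by blast
    have small: "2 / (real i + 1) < \<epsilon> / 3" if "i \<ge> M2" for i
    proof -
      have "6 / \<epsilon> < real i + 1" using M2 that by linarith
      then show ?thesis using \<open>\<epsilon> > 0\<close> by (simp add: field_simps)
    qed
    have "h.Q (Y i - Y j) < \<epsilon>" if ij: "i \<ge> max M1 M2" "j \<ge> max M1 M2" for i j
    proof -
      \<comment> \<open>each of the three terms of \<open>hdiff\<close> is at most a third of \<open>\<epsilon>\<close>\<close>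
      have "\<bar>l\<bar> * ip.Q (Y i - Y j) \<le> \<bar>l\<bar> * d"
        using M1[of i j] ij by (intro mult_left_mono) auto
      also have "\<dots> \<le> (\<bar>l\<bar> + 1) * (\<epsilon> / (3 * (\<bar>l\<bar> + 1)))"
        using d by (intro mult_mono) (auto simp: d_def)
      also have "\<dots> = \<epsilon> / 3"
      proof -
        have "a * (\<epsilon> / (3 * a)) = \<epsilon> / 3" if "a > 0" for a using that by simp
        from this[of "\<bar>l\<bar> + 1"] show ?thesis by simp
      qed
      finally show ?thesis using hdiff[of i j] small[of i] small[of j] ij by simp
    qed
    moreover have "ip.Q (Y i - Y j) < \<epsilon>" if "i \<ge> max M1 M2" "j \<ge> max M1 M2" for i j
      using M1[of i j] that by (auto simp: d_def)
    ultimately show ?thesis by blast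
  qed
  then obtain y where y: "y \<in> V" and ylim: "(\<lambda>n. ip.Q (Y n - y)) \<longlonglongrightarrow> 0" "(\<lambda>n. h.Q (Y n - y)) \<longlonglongrightarrow> 0"
    using complete[of Y] Y by blast
  have "(\<lambda>k. ip.Q (Y k)) \<longlonglongrightarrow> ip.Q y" using Y y ylim by (intro ip.tendsto_Q) auto
  then have y1: "ip.Q y = 1" using Y by (simp add: LIMSEQ_const_iff)
  have "(\<lambda>k. h.Q (Y k)) \<longlonglongrightarrow> h.Q y" using Y y ylim by (intro h.tendsto_Q) auto
  moreover have "(\<lambda>k. l + 1 / (real k + 1)) \<longlonglongrightarrow> l + 0"
    by (intro tendsto_add tendsto_const) (use LIMSEQ_inverse_real_of_nat in \<open>simp add: inverse_eq_divide add.commute\<close>)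
  ultimately have yh: "h.Q y \<le> l"
    using Yh by (intro LIMSEQ_le[of "\<lambda>k. h.Q (Y k)" "h.Q y" "\<lambda>k. l + 1 / (real k + 1)"]) (auto intro: less_imp_le)
  have "ip y (u i) = 0" if "i < n" for i
  proof -
    have "(\<lambda>k. ip (Y k) (u i)) \<longlonglongrightarrow> ip y (u i)"
      using Y y ylim u that by (intro ip.tendsto_left) auto
    moreover have "ip (Y k) (u i) = 0" for k using Y(1)[of k] that by (simp add: W_def)
    ultimately show ?thesis by (simp add: LIMSEQ_const_iff)
  qed
  moreover have "h.Q y * ip.Q x \<le> h.Q x" if "x \<in> V" "\<And>i. i < n \<Longrightarrow> ip x (u i) = 0" for x
  proof -
    have "h.Q y * ip.Q x \<le> l * ip.Q x" using yh that by (intro mult_right_mono ip.Q_nonneg) auto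
    also have "\<dots> \<le> h.Q x" using that by (intro lower) (auto simp: W_def)
    finally show ?thesis .
  qed
  ultimately show ?thesis using that y y1 by blast
qed

text \<open>The Euler-Lagrange equation without derivatives: the form \<open>h - h.Q y * ip\<close> is non-negative on \<open>W\<close> and
vanishes at \<open>y\<close>, so by the Cauchy-Schwarz inequality for this semi-definite form \<open>y\<close> is orthogonal
to all of \<open>W\<close>.\<close>
lemma minimizer_satisfies_equation:
  assumes W: "ip.subspace W" "W \<subseteq> V" and y: "y \<in> W" "ip.Q y = 1"
    and min: "\<And>x. x \<in> W \<Longrightarrow> h.Q y * ip.Q x \<le> h.Q x" and z: "z \<in> W"
  shows "h y z = of_real (h.Q y) * ip y z"
proof -
  define q where "q a b = h a b - of_real (h.Q y) * ip a b" for a b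
  interpret q: hermitian_form scale W q
  proof unfold_locales
    show "ip.subspace W" by fact
    show "q (a + b) c = q a c + q b c" if "a \<in> W" "b \<in> W" "c \<in> W" for a b c
      using that W by (simp add: q_def h.add_left ip.add_left subset_iff algebra_simps)
    show "q (t *s a) c = t * q a c" if "a \<in> W" "c \<in> W" for t a c
      using that W by (simp add: q_def h.scale_left ip.scale_left subset_iff algebra_simps)
    show "q b a = cnj (q a b)" if "a \<in> W" "b \<in> W" for a b
      using that W h.hermitian[of a b] ip.hermitian[of a b] by (simp add: q_def subset_iff)
    show "0 \<le> Re (q a a)" if "a \<in> W" for a
      using min[OF that] by (simp add: q_def h.Q_def ip.Q_def)
  qed
  have "q.Q y = 0" using y by (simp add: q.Q_def q_def h.Q_def ip.Q_def)
  then have "(cmod (q y z))\<^sup>2 \<le> 0" using q.Cauchy_Schwarz[OF y(1) z] by simp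
  then show ?thesis by (simp add: q_def)
qed

text \<open>Iterating the minimization: each vector minimizes the Rayleigh quotient among all vectors orthogonal
to the previous ones. The weak equation, known at first for test vectors in that complement,
extends to all of \<open>V\<close> because the previous vectors are themselves eigenvectors and hence
orthogonal to the new one also with respect to \<open>h\<close>.\<close>
lemma exists_spectral_sequence:
  obtains e lam where
    "\<And>n::nat. e n \<in> eigen (lam n)" "\<And>n. ip.Q (e n) = 1"
    "\<And>m n. m \<noteq> n \<Longrightarrow> ip (e m) (e n) = 0"
    "\<And>n x. x \<in> V \<Longrightarrow> (\<And>i. i < n \<Longrightarrow> ip x (e i) = 0) \<Longrightarrow> lam n * ip.Q x \<le> h.Q x"
    "\<And>n. lam n = h.Q (e n)"
proof -
  define P where "P f n r \<longleftrightarrow> ((\<forall>i<n. f i \<in> V) \<longrightarrow> r \<in> V \<and> ip.Q r = 1 \<and> (\<forall>i<n. ip r (f i) = 0) \<and>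
      (\<forall>x\<in>V. (\<forall>i<n. ip x (f i) = 0) \<longrightarrow> h.Q r * ip.Q x \<le> h.Q x))" for f and n :: nat and r
  have "\<exists>e. \<forall>n. P e n (e n)"
  proof (rule dependent_wellorder_choice)
    show "P f n r = P g n r" if "\<And>k. k < n \<Longrightarrow> f k = g k" for r f g n
      unfolding P_def using that by simp
    show "\<exists>r. P f n r" for n f
    proof (cases "\<forall>i<n. f i \<in> V")
      case True
      then show ?thesis
        using exists_minimizer[of n f] unfolding P_def by metis
    qed (auto simp: P_def)
  qed
  then obtain e where Pe: "\<And>n. P e n (e n)" by blast
  have eV: "e n \<in> V" for n
  proof (induction n rule: less_induct)
    case (less n)
    then show ?case using Pe[of n] unfolding P_def by blast
  qed
  have unit: "ip.Q (e n) = 1" and orth: "i < n \<Longrightarrow> ip (e n) (e i) = 0"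
    and min: "x \<in> V \<Longrightarrow> (\<And>i. i < n \<Longrightarrow> ip x (e i) = 0) \<Longrightarrow> h.Q (e n) * ip.Q x \<le> h.Q x" for n i x
    using Pe[of n] eV unfolding P_def by blast+
  have orth': "ip (e m) (e n) = 0" if "m \<noteq> n" for m n
    using that orth[of m n] orth[of n m] ip.hermitian[OF eV eV, of m n] by (cases "m < n") auto
  have eigen: "e n \<in> eigen (h.Q (e n))" for n
  proof (induction n rule: less_induct)
    case (less n)
    define W where "W = {x \<in> V. \<forall>i<n. ip x (e i) = 0}"
    have sub: "ip.subspace W"
      unfolding W_def by (rule ip.subspaceI) (auto simp: eV ip.zero_left ip.add_left ip.scale_left)
    have eqW: "h (e n) z = of_real (h.Q (e n)) * ip (e n) z" if "z \<in> W" for z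
      using sub that eV unit orth min
      by (intro minimizer_satisfies_equation[of W]) (auto simp: W_def)
    have eqi: "h (e n) (e i) = 0" if "i < n" for i
    proof -
      have "h (e i) (e n) = of_real (h.Q (e i)) * ip (e i) (e n)"
        using less[OF that] eV by (simp add: eigen_def)
      then show ?thesis using orth'[of i n] that h.hermitian[OF eV eV, of i n] by simp
    qed
    have "h (e n) y = of_real (h.Q (e n)) * ip (e n) y" if y: "y \<in> V" for y
    proof -
      define p where "p = (\<Sum>i<n. ip y (e i) *s e i)"
      have pV: "p \<in> V" unfolding p_def using eV by auto
      have "ip p (e j) = ip y (e j)" if "j < n" for j
      proof -
        have "ip p (e j) = (\<Sum>i<n. ip y (e i) * ip (e i) (e j))"
          unfolding p_def using eV by (intro ip.sum_left) auto
        also have "\<dots> = (\<Sum>i<n. if i = j then ip y (e j) else 0)"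
          using orth' ip.diagonal[OF eV] unit by (intro sum.cong) auto
        finally show ?thesis using that by simp
      qed
      then have "y - p \<in> W" using y pV eV by (simp add: W_def ip.diff_left)
      then have 1: "h (e n) (y - p) = of_real (h.Q (e n)) * ip (e n) (y - p)" by (rule eqW)
      have "h (e n) p = (\<Sum>i<n. cnj (ip y (e i)) * h (e n) (e i))"
        unfolding p_def using eV by (intro h.sum_right) auto
      also have "\<dots> = 0" using eqi by simp
      finally have 2: "h (e n) p = 0" .
      have "ip (e n) p = (\<Sum>i<n. cnj (ip y (e i)) * ip (e n) (e i))"
        unfolding p_def using eV by (intro ip.sum_right) auto
      also have "\<dots> = 0" using orth by simp
      finally have 3: "ip (e n) p = 0" .
      show ?thesis using 1 2 3 y pV eV by (simp add: h.diff_right ip.diff_right)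
    qed
    then show ?case using eV by (simp add: eigen_def)
  qed
  show ?thesis by (rule that[of e "\<lambda>n. h.Q (e n)"]) (use eigen unit orth' min in auto)
qed

text \<open>The abstract counterpart of \<open>eigenvalue_enumeration\<close>.\<close>
definition eigenvalue_sequence :: "(nat \<Rightarrow> real) \<Rightarrow> bool" where
  "eigenvalue_sequence lam \<longleftrightarrow> mono lam \<and>
     (\<forall>\<mu>. finite {n. lam n = \<mu>} \<and> (\<exists>B. finite B \<and> eigen \<mu> = ip.span B) \<and>
          ip.dim (eigen \<mu>) = card {n. lam n = \<mu>})"

definition eigenbasis :: "(nat \<Rightarrow> 'a) \<Rightarrow> (nat \<Rightarrow> real) \<Rightarrow> bool" where
  "eigenbasis e lam \<longleftrightarrow> mono lam \<and> (\<forall>n. e n \<in> eigen (lam n)) \<and> (\<forall>n. ip.Q (e n) = 1) \<and>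
     (\<forall>m n. m \<noteq> n \<longrightarrow> ip (e m) (e n) = 0) \<and> (\<forall>\<mu>. eigen \<mu> = ip.span (e ` {n. lam n = \<mu>}))"

text \<open>The Rayleigh minima tend to infinity, because infinitely many orthonormal vectors of bounded energy
cannot have a Cauchy subsequence. So multiplicities are finite, and no eigenvector is missed:
what remains of an eigenvector after projecting it off the basis vectors with its own eigenvalue is
orthogonal to all basis vectors, its Rayleigh quotient would exceed all minima, and so it is zero.\<close>
theorem exists_eigenbasis:
  obtains e lam where "eigenbasis e lam" "eigenvalue_sequence lam"
proof -
  obtain e lam where e: "\<And>n::nat. e n \<in> eigen (lam n)" "\<And>n. ip.Q (e n) = 1"
    and orth: "\<And>m n. m \<noteq> n \<Longrightarrow> ip (e m) (e n) = 0"
    and min: "\<And>n x. x \<in> V \<Longrightarrow> (\<And>i. i < n \<Longrightarrow> ip x (e i) = 0) \<Longrightarrow> lam n * ip.Q x \<le> h.Q x"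
    and lam: "\<And>n. lam n = h.Q (e n)"
    using exists_spectral_sequence by blast
  have eV: "e n \<in> V" for n using e(1)[of n] by (simp add: eigen_def)
  have mono: "lam m \<le> lam n" if "m \<le> n" for m n
    using min[of "e n" m] eV e(2)[of n] orth[of n] that lam by simp
  have unbounded: "\<exists>n. lam n > B" for B
  proof (rule ccontr)
    assume "\<not> ?thesis"
    then have B: "lam n \<le> B" for n by (simp add: not_less)
    have "\<exists>r::nat\<Rightarrow>nat. strict_mono r \<and>
          (\<forall>\<epsilon>>0. \<exists>M. \<forall>i\<ge>M. \<forall>j\<ge>M. ip.Q (e (r i) - e (r j)) < \<epsilon>)"
      by (rule compact[of e "max 1 B"]) (use eV e(2) B in \<open>auto simp flip: lam intro: max.coboundedI2\<close>)
    then obtain r :: "nat \<Rightarrow> nat" where r: "strict_mono r"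
      and c: "\<And>\<epsilon>. \<epsilon> > 0 \<Longrightarrow> \<exists>M. \<forall>i\<ge>M. \<forall>j\<ge>M. ip.Q (e (r i) - e (r j)) < \<epsilon>"
      by blast
    obtain M where "\<forall>i\<ge>M. \<forall>j\<ge>M. ip.Q (e (r i) - e (r j)) < 1" using c[of 1] by auto
    then have "ip.Q (e (r M) - e (r (Suc M))) < 1" by simp
    moreover have "r M \<noteq> r (Suc M)" using r by (auto simp: strict_mono_eq)
    moreover have "ip.Q (e i - e j) = 2" if "i \<noteq> j" for i j
      using orth[OF that] e(2)[of i] e(2)[of j] eV
      by (simp add: ip.Q_parallelogram ip.Q_add)
    ultimately show False by simp
  qed
  have finite_le: "finite {n. lam n \<le> t}" for t
  proof -
    obtain k where k: "lam k > t" using unbounded by blast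
    have "{n. lam n \<le> t} \<subseteq> {..<k}"
    proof
      fix n assume "n \<in> {n. lam n \<le> t}"
      then show "n \<in> {..<k}" using k mono[of k n] by (cases "n < k") auto
    qed
    then show ?thesis by (rule finite_subset) simp
  qed
  have fin: "finite {n. lam n = \<mu>}" for \<mu>
    by (rule finite_subset[OF _ finite_le[of \<mu>]]) auto
  have inj: "inj e"
  proof (rule injI, rule ccontr)
    fix m n assume "e m = e n" "m \<noteq> n"
    then show False using orth[of m n] ip.diagonal[OF eV, of n] e(2)[of n] by simp
  qed
  have sub: "ip.subspace (eigen \<mu>)" for \<mu>
    unfolding eigen_def
    by (rule ip.subspaceI)
       (auto simp: ip.zero_left h.zero_left ip.add_left h.add_left ip.scale_left h.scale_left algebra_simps)
  have eig: "eigen \<mu> = ip.span (e ` {n. lam n = \<mu>})" for \<mu>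
  proof
    show "ip.span (e ` {n. lam n = \<mu>}) \<subseteq> eigen \<mu>"
      by (rule ip.span_minimal[OF _ sub]) (use e in auto)
    show "eigen \<mu> \<subseteq> ip.span (e ` {n. lam n = \<mu>})"
    proof
      fix x assume x: "x \<in> eigen \<mu>"
      then have xV: "x \<in> V" by (simp add: eigen_def)
      define p where "p = (\<Sum>i | lam i = \<mu>. ip x (e i) *s e i)"
      have p: "p \<in> ip.span (e ` {n. lam n = \<mu>})"
        unfolding p_def by (intro ip.span_sum ip.span_scale ip.span_base) auto
      with e(1) have p': "p \<in> eigen \<mu>" using \<open>ip.span _ \<subseteq> eigen \<mu>\<close> by blast
      then have pV: "p \<in> V" by (simp add: eigen_def)
      define y where "y = x - p"
      have y: "y \<in> eigen \<mu>" unfolding y_def using x p' sub ip.subspace_diff by blast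
      then have yV: "y \<in> V" by (simp add: eigen_def)
      have "ip y (e j) = 0" for j
      proof (cases "lam j = \<mu>")
        case True
        have "ip p (e j) = (\<Sum>i | lam i = \<mu>. ip x (e i) * ip (e i) (e j))"
          unfolding p_def using eV by (intro ip.sum_left) auto
        also have "\<dots> = (\<Sum>i | lam i = \<mu>. if i = j then ip x (e j) else 0)"
          using orth ip.diagonal[OF eV] e(2) by (intro sum.cong) auto
        also have "\<dots> = ip x (e j)" using True fin by simp
        finally show ?thesis unfolding y_def using xV pV eV by (simp add: ip.diff_left)
      next
        case False
        have "of_real \<mu> * ip y (e j) = h y (e j)" using y eV by (simp add: eigen_def)
        also have "\<dots> = cnj (h (e j) y)" using eV yV by (rule h.hermitian)
        also have "h (e j) y = of_real (lam j) * ip (e j) y" using e(1)[of j] yV by (simp add: eigen_def)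
        also have "cnj \<dots> = of_real (lam j) * ip y (e j)" using ip.hermitian[OF eV yV, of j] by simp
        finally have "of_real \<mu> * ip y (e j) = of_real (lam j) * ip y (e j)" .
        then show ?thesis using False by auto
      qed
      then have "lam n * ip.Q y \<le> h.Q y" for n using min[OF yV] by blast
      moreover have "h.Q y = \<mu> * ip.Q y"
        using y yV by (simp add: eigen_def h.Q_def ip.Q_def)
      moreover obtain n where "lam n > \<mu>" using unbounded by blast
      ultimately have "(lam n - \<mu>) * ip.Q y \<le> 0" "lam n - \<mu> > 0" by (auto simp: algebra_simps)
      then have "ip.Q y \<le> 0" by (simp add: mult_le_0_iff)
      then have "y = 0" using definite[OF yV] ip.Q_nonneg[OF yV] by simp
      then show "x \<in> ip.span (e ` {n. lam n = \<mu>})" using p by (simp add: y_def)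
    qed
  qed
  have indep: "ip.independent (e ` A)" if "finite A" for A
  proof -
    have "c v = 0" if "v \<in> e ` A" and sum0: "(\<Sum>v\<in>e ` A. c v *s v) = 0" for c v
    proof -
      obtain j where j: "j \<in> A" "v = e j" using \<open>v \<in> e ` A\<close> by auto
      have "(\<Sum>i\<in>A. c (e i) *s e i) = 0"
        using sum0 inj by (simp add: sum.reindex inj_on_subset[OF inj])
      then have "0 = ip (\<Sum>i\<in>A. c (e i) *s e i) (e j)" using ip.zero_left eV by simp
      also have "\<dots> = (\<Sum>i\<in>A. c (e i) * ip (e i) (e j))" using eV by (intro ip.sum_left) auto
      also have "\<dots> = (\<Sum>i\<in>A. if i = j then c (e j) else 0)"
        using orth ip.diagonal[OF eV] e(2) by (intro sum.cong) auto
      also have "\<dots> = c (e j)" using j \<open>finite A\<close> by simp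
      finally show ?thesis using j by simp
    qed
    then show ?thesis using \<open>finite A\<close> by (auto simp: ip.dependent_finite)
  qed
  have "ip.dim (eigen \<mu>) = card {n. lam n = \<mu>}" for \<mu>
    unfolding eig using indep[OF fin] inj
    by (metis card_image inj_on_subset ip.dim_eq_card_independent ip.dim_span subset_UNIV)
  then have "eigenvalue_sequence lam"
    using fin mono eig unfolding eigenvalue_sequence_def mono_def by (metis finite_imageI)
  moreover have "eigenbasis e lam"
    using mono e orth eig by (simp add: eigenbasis_def mono_def)
  ultimately show ?thesis using that by blast
qed

text \<open>The step from a lower bound for a constrained problem to a lower bound for \<open>lam n\<close>: the span of the
first \<open>n + 1\<close> eigenvectors has energy at most \<open>lam n\<close>, and it is large enough to satisfy \<open>n\<close> linear
side conditions. The functionals \<open>T j\<close> will be point evaluations.\<close>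
lemma low_energy_vector_in_kernel:
  fixes T :: "nat \<Rightarrow> 'a \<Rightarrow> complex"
  assumes basis: "eigenbasis e lam"
    and T: "\<And>j c. T j (\<Sum>i\<le>n. c i *s e i) = (\<Sum>i\<le>n. c i * T j (e i))"
  obtains x where "x \<in> V" "x \<noteq> 0" "\<And>j. j < n \<Longrightarrow> T j x = 0" "h.Q x \<le> lam n * ip.Q x"
proof -
  have "mono lam" and e: "\<And>n. e n \<in> eigen (lam n)" "\<And>n. ip.Q (e n) = 1"
    and orth: "\<And>m n. m \<noteq> n \<Longrightarrow> ip (e m) (e n) = 0"
    using basis by (auto simp: eigenbasis_def)
  have eV: "e n \<in> V" for n using e(1)[of n] by (simp add: eigen_def)
  obtain c where c: "\<exists>i\<in>{..n}. c i \<noteq> 0" "\<And>j. j \<in> {..<n} \<Longrightarrow> (\<Sum>i\<le>n. T j (e i) * c i) = 0"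
    by (rule homogeneous_system_nontrivial_solution[of "{..<n}" "{..n}" "\<lambda>j i. T j (e i)"]) auto
  define x where "x = (\<Sum>i\<le>n. c i *s e i)"
  have xV: "x \<in> V" unfolding x_def using eV by auto
  have coeff: "ip (e k) x = cnj (c k)" if "k \<le> n" for k
  proof -
    have "ip (e k) x = (\<Sum>i\<le>n. cnj (c i) * ip (e k) (e i))"
      unfolding x_def using eV by (intro ip.sum_right) auto
    also have "\<dots> = (\<Sum>i\<le>n. if i = k then cnj (c k) else 0)"
      using orth ip.diagonal[OF eV] e(2) by (intro sum.cong) auto
    finally show ?thesis using that by simp
  qed
  have hcoeff: "h (e k) x = of_real (lam k) * cnj (c k)" if "k \<le> n" for k
    using e(1)[of k] xV coeff[OF that] by (simp add: eigen_def)
  have "ip x x = (\<Sum>i\<le>n. c i * ip (e i) x)"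
    by (subst x_def) (use eV xV in \<open>intro ip.sum_left; auto\<close>)
  also have "\<dots> = (\<Sum>i\<le>n. of_real ((cmod (c i))\<^sup>2))"
    by (intro sum.cong) (auto simp: coeff complex_norm_square simp del: of_real_power)
  finally have N: "ip.Q x = (\<Sum>i\<le>n. (cmod (c i))\<^sup>2)" by (simp add: ip.Q_def flip: of_real_power)
  have "h x x = (\<Sum>i\<le>n. c i * h (e i) x)"
    by (subst x_def) (use eV xV in \<open>intro h.sum_left; auto\<close>)
  also have "\<dots> = (\<Sum>i\<le>n. of_real (lam i * (cmod (c i))\<^sup>2))"
    by (intro sum.cong) (auto simp: hcoeff complex_norm_square simp del: of_real_power)
  finally have "h.Q x = (\<Sum>i\<le>n. lam i * (cmod (c i))\<^sup>2)"
    by (simp add: h.Q_def flip: of_real_power of_real_mult)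
  also have "\<dots> \<le> (\<Sum>i\<le>n. lam n * (cmod (c i))\<^sup>2)"
    using \<open>mono lam\<close> by (intro sum_mono mult_right_mono) (auto simp: mono_def)
  also have "\<dots> = lam n * ip.Q x" by (simp add: N sum_distrib_left)
  finally have "h.Q x \<le> lam n * ip.Q x" .
  moreover have "ip.Q x > 0"
  proof -
    obtain k where "k \<le> n" "c k \<noteq> 0" using c(1) by auto
    then show ?thesis unfolding N by (intro sum_pos2[of _ k]) auto
  qed
  then have "x \<noteq> 0" using ip.zero_left[OF ip.V_intros(1)] by (auto simp: ip.Q_def)
  moreover have "T j x = 0" if "j < n" for j
    using c(2)[of j] that by (simp add: x_def T mult.commute)
  ultimately show ?thesis using that xV by blast
qed

end

section \<open>Sequences with prescribed multiplicities\<close>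

text \<open>This makes the definite description in \<open>delta_eigenvalue\<close> meaningful. If \<open>f k < g k\<close>, then the number
of indices with value at most \<open>f k\<close> is at least \<open>k + 1\<close> for \<open>f\<close> but at most \<open>k\<close> for \<open>g\<close>, although it is
determined by the multiplicities.\<close>
lemma mono_sequence_determined_by_multiplicities:
  fixes f g :: "nat \<Rightarrow> 'a::linorder"
  assumes "mono f" "mono g"
    and fin: "\<And>t. finite {n. f n = t}" "\<And>t. finite {n. g n = t}"
    and card: "\<And>t. card {n. f n = t} = card {n. g n = t}"
  shows "f = g"
proof -
  have not_less: "\<not> f k < g k"
    if "mono f" "mono g" and fin: "\<And>t. finite {n. f n = t}" "\<And>t. finite {n. g n = t}"
      and card: "\<And>t. card {n. f n = t} = card {n. g n = t}"
    for f g :: "nat \<Rightarrow> 'a" and k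
  proof
    assume less: "f k < g k"
    define S where "S = {t \<in> range g. t \<le> f k}"
    have sub: "{n. g n \<le> f k} \<subseteq> {..<k}"
    proof
      fix n assume "n \<in> {n. g n \<le> f k}"
      then show "n \<in> {..<k}" using less monoD[OF \<open>mono g\<close>, of k n] by (cases "n < k") auto
    qed
    then have "finite (g ` {n. g n \<le> f k})" by (metis finite_imageI finite_lessThan finite_subset)
    moreover have "S = g ` {n. g n \<le> f k}" by (auto simp: S_def)
    ultimately have finS: "finite S" by simp
    have range: "range f = range g"
    proof -
      have "t \<in> range f \<longleftrightarrow> t \<in> range g" for t
      proof -
        have "t \<in> range f \<longleftrightarrow> {n. f n = t} \<noteq> {}" by blast
        also have "\<dots> \<longleftrightarrow> {n. g n = t} \<noteq> {}"
          using card[of t] fin(1)[of t] fin(2)[of t] card_eq_0_iff by metis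
        also have "\<dots> \<longleftrightarrow> t \<in> range g" by blast
        finally show ?thesis .
      qed
      then show ?thesis by blast
    qed
    have "{n. g n \<le> f k} = (\<Union>t\<in>S. {n. g n = t})" by (auto simp: S_def)
    then have 1: "card {n. g n \<le> f k} = (\<Sum>t\<in>S. card {n. g n = t})"
      using finS fin by (subst card_UN_disjoint[symmetric]) auto
    have "{n. f n \<le> f k} = (\<Union>t\<in>S. {n. f n = t})" by (auto simp: S_def simp flip: range)
    then have 2: "card {n. f n \<le> f k} = (\<Sum>t\<in>S. card {n. f n = t})"
      and fin_le: "finite {n. f n \<le> f k}"
      using finS fin by (auto intro!: card_UN_disjoint)
    have "card {..k} \<le> card {n. f n \<le> f k}"
      using monoD[OF \<open>mono f\<close>] by (intro card_mono fin_le) auto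
    moreover have "card {n. g n \<le> f k} \<le> card {..<k}" using sub by (intro card_mono) auto
    ultimately show False using 1 2 card by simp
  qed
  show ?thesis
  proof
    fix k
    show "f k = g k"
      using not_less[OF assms(1,2) fin card, of k] not_less[OF assms(2,1) fin(2,1) card[symmetric], of k]
      by (meson linorder_neq_iff)
  qed
qed

section \<open>Absolutely continuous functions\<close>

text \<open>\<open>\<phi>\<close> is absolutely continuous on $[a,b]$ with derivative \<open>g\<close>. This is the notion behind
\<open>is_H1_deriv\<close>, but for subintervals and expressed by the gauge integral, for which additivity over
intervals and the fundamental theorem of calculus are at hand.\<close>
definition ac :: "real \<Rightarrow> real \<Rightarrow> (real \<Rightarrow> complex) \<Rightarrow> (real \<Rightarrow> complex) \<Rightarrow> bool" where
  "ac a b \<phi> g \<longleftrightarrow> g absolutely_integrable_on {a..b} \<and>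
     (\<forall>x\<in>{a..b}. \<phi> x = \<phi> a + integral {a..x} g)"

lemma ac_eq: "ac a b \<phi> g \<Longrightarrow> x \<in> {a..b} \<Longrightarrow> \<phi> x = \<phi> a + integral {a..x} g"
  unfolding ac_def by blast

lemma ac_absolutely_integrable: "ac a b \<phi> g \<Longrightarrow> g absolutely_integrable_on {a..b}"
  unfolding ac_def by blast

lemma ac_integrable: "ac a b \<phi> g \<Longrightarrow> a \<le> x \<Longrightarrow> y \<le> b \<Longrightarrow> g integrable_on {x..y}"
  by (rule integrable_subinterval_real[of g a b]) (auto dest: ac_absolutely_integrable simp: absolutely_integrable_on_def)

lemma ac_diff:
  assumes "ac a b \<phi> g" "a \<le> x" "x \<le> y" "y \<le> b"
  shows "\<phi> y = \<phi> x + integral {x..y} g"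
proof -
  have "integral {a..x} g + integral {x..y} g = integral {a..y} g"
    using assms ac_integrable[OF assms(1), of a y]
    by (intro Henstock_Kurzweil_Integration.integral_combine) auto
  moreover have "\<phi> x = \<phi> a + integral {a..x} g" "\<phi> y = \<phi> a + integral {a..y} g"
    using assms by (auto intro!: ac_eq)
  ultimately show ?thesis by (simp add: algebra_simps)
qed

lemma ac_subinterval:
  assumes "ac a b \<phi> g" "a \<le> c" "c \<le> d" "d \<le> b"
  shows "ac c d \<phi> g"
proof -
  have "g absolutely_integrable_on {c..d}"
    by (rule absolutely_integrable_on_subinterval[OF ac_absolutely_integrable[OF assms(1)]])
      (use assms(2-4) in simp)
  moreover have "\<phi> x = \<phi> c + integral {c..x} g" if "x \<in> {c..d}" for x
    using that assms by (intro ac_diff[OF assms(1)]) auto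
  ultimately show ?thesis unfolding ac_def by blast
qed

lemma ac_continuous:
  assumes "ac a b \<phi> g"
  shows "continuous_on {a..b} \<phi>"
proof -
  have "continuous_on {a..b} (\<lambda>x. \<phi> a + integral {a..x} g)"
    using ac_integrable[OF assms order_refl order_refl]
    by (intro continuous_intros indefinite_integral_continuous_1)
  then show ?thesis
    by (rule continuous_on_eq) (rule ac_eq[OF assms, symmetric])
qed

lemma ac_cnj: "ac a b \<phi> g \<Longrightarrow> ac a b (\<lambda>x. cnj (\<phi> x)) (\<lambda>x. cnj (g x))"
proof -
  assume \<phi>: "ac a b \<phi> g"
  have "cnj (\<phi> x) = cnj (\<phi> a) + integral {a..x} (\<lambda>x. cnj (g x))" if "x \<in> {a..b}" for x
    using arg_cong[OF ac_eq[OF \<phi> that], of cnj] by (simp add: integral_cnj)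
  then show ?thesis
    using absolutely_integrable_linear[OF ac_absolutely_integrable[OF \<phi>] bounded_linear_cnj]
    unfolding ac_def o_def by blast
qed

lemma ac_smooth:
  assumes "a \<le> b"
    and deriv: "\<And>x. x \<in> {a..b} \<Longrightarrow> (\<phi> has_vector_derivative \<phi>' x) (at x within {a..b})"
    and cont: "continuous_on {a..b} \<phi>'"
  shows "ac a b \<phi> \<phi>'"
  unfolding ac_def
proof (intro conjI ballI)
  show "\<phi>' absolutely_integrable_on {a..b}"
    using cont by (rule absolutely_integrable_continuous_real)
  fix x assume x: "x \<in> {a..b}"
  have "(\<phi>' has_integral (\<phi> x - \<phi> a)) {a..x}"
  proof (rule fundamental_theorem_of_calculus)
    show "(\<phi> has_vector_derivative \<phi>' t) (at t within {a..x})" if "t \<in> {a..x}" for t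
      using deriv[of t] x that by (auto intro: has_vector_derivative_within_subset)
  qed (use x in auto)
  then show "\<phi> x = \<phi> a + integral {a..x} \<phi>'" by (simp add: integral_unique)
qed

text \<open>Fubini on the square $[a,b]^2$, split along the diagonal: the two terms on the left are the integrals
of \<open>g x * k y\<close> over the triangles \<open>y \<le> x\<close> and \<open>x < y\<close>.\<close>
lemma integral_mult_integral_swap:
  fixes g k :: "real \<Rightarrow> complex"
  assumes g: "g absolutely_integrable_on {a..b}" and k: "k absolutely_integrable_on {a..b}"
  defines "G \<equiv> \<lambda>x. integral {a..x} g" and "K \<equiv> \<lambda>x. integral {a..x} k"
  shows "integral {a..b} (\<lambda>x. g x * K x) + integral {a..b} (\<lambda>x. G x * k x) = G b * K b"
proof -
  define M where "M = lebesgue_on {a..b}"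
  interpret M: finite_measure M
    unfolding M_def by (rule finite_measure_lebesgue_on) auto
  interpret P: pair_sigma_finite M M ..
  have gM: "integrable M g" and kM: "integrable M k"
    using g k by (auto simp: M_def intro: absolutely_integrable_imp_integrable)
  note [measurable] = borel_measurable_integrable[OF gM] borel_measurable_integrable[OF kM]
  have id[measurable]: "(\<lambda>x. x) \<in> M \<rightarrow>\<^sub>M borel"
    unfolding M_def by (intro continuous_imp_measurable_on_sets_lebesgue continuous_intros) auto
  have fst[measurable]: "fst \<in> borel_measurable (M \<Otimes>\<^sub>M M)" and snd[measurable]: "snd \<in> borel_measurable (M \<Otimes>\<^sub>M M)"
    using measurable_compose[OF measurable_fst id] measurable_compose[OF measurable_snd id] by auto
  have prod: "integrable (M \<Otimes>\<^sub>M M) (\<lambda>(x, y). g x * k y)"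
    by (rule P.Fubini_integrable) (use gM kM in \<open>auto simp: norm_mult\<close>)
  define A where "A = (\<lambda>x y. if y \<le> x then g x * k y else 0)"
  define B where "B = (\<lambda>x y. if x < y then g x * k y else 0)"
  have meas: "case_prod A \<in> borel_measurable (M \<Otimes>\<^sub>M M)" "case_prod B \<in> borel_measurable (M \<Otimes>\<^sub>M M)"
    unfolding A_def B_def by measurable
  have A: "integrable (M \<Otimes>\<^sub>M M) (case_prod A)" and B: "integrable (M \<Otimes>\<^sub>M M) (case_prod B)"
    by (rule Bochner_Integration.integrable_bound[OF prod meas(1)], auto simp: A_def)
       (rule Bochner_Integration.integrable_bound[OF prod meas(2)], auto simp: B_def)
  have conv: "integrable M f \<Longrightarrow> integral\<^sup>L M f = integral {a..b} f" for f :: "real \<Rightarrow> complex"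
    unfolding M_def by (rule lebesgue_integral_eq_integral) auto
  have part: "(LINT y|M. (if y \<le> x then f y else 0)) = integral {a..x} f"
             "(LINT y|M. (if y < x then f y else 0)) = integral {a..x} f"
    if x: "x \<in> {a..b}" and f: "integrable M f" for f :: "real \<Rightarrow> complex" and x
  proof -
    note [measurable] = borel_measurable_integrable[OF f]
    have 1: "integrable M (\<lambda>y. if y \<le> x then f y else 0)" "integrable M (\<lambda>y. if y < x then f y else 0)"
      by (rule Bochner_Integration.integrable_bound[OF f],
          rule measurable_If[OF borel_measurable_integrable[OF f] borel_measurable_const],
          auto intro: borel_measurable_le borel_measurable_less id)+
    have "integral {a..b} (\<lambda>y. if y \<le> x then f y else 0) = integral {a..b} (\<lambda>y. if y \<in> {..x} then f y else 0)"
      by (rule integral_cong) auto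
    also have "\<dots> = integral ({..x} \<inter> {a..b}) f" by (rule integral_restrict_Int)
    also have "{..x} \<inter> {a..b} = {a..x}" using x by auto
    finally have 2: "integral {a..b} (\<lambda>y. if y \<le> x then f y else 0) = integral {a..x} f" .
    have "integral {a..b} (\<lambda>y. if y < x then f y else 0) = integral {a..b} (\<lambda>y. if y \<le> x then f y else 0)"
      by (rule integral_spike[of "{x}"]) auto
    with 1 2 conv show "(LINT y|M. (if y \<le> x then f y else 0)) = integral {a..x} f"
      "(LINT y|M. (if y < x then f y else 0)) = integral {a..x} f" by auto
  qed
  have sp: "space M = {a..b}" by (simp add: M_def)
  have intA: "(LINT y|M. A x y) = g x * K x" if "x \<in> space M" for x
  proof -
    have "A x = (\<lambda>y. g x * (if y \<le> x then k y else 0))" by (auto simp: A_def)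
    then show ?thesis using part(1)[of x k] that kM by (simp add: K_def sp)
  qed
  have intB: "(LINT x|M. B x y) = G y * k y" if "y \<in> space M" for y
  proof -
    have "(\<lambda>x. B x y) = (\<lambda>x. (if x < y then g x else 0) * k y)" by (auto simp: B_def)
    then show ?thesis using part(2)[of y g] that gM by (simp add: G_def sp)
  qed
  have iA: "integrable M (\<lambda>x. g x * K x)"
    using P.integrable_fst[OF A] by (rule Bochner_Integration.integrable_cong[THEN iffD1, rotated 2]) (auto simp: intA)
  have iB: "integrable M (\<lambda>y. G y * k y)"
    using P.integrable_snd[OF B] by (rule Bochner_Integration.integrable_cong[THEN iffD1, rotated 2]) (auto simp: intB)
  have "integral {a..b} (\<lambda>x. g x * K x) + integral {a..b} (\<lambda>x. G x * k x)
      = (LINT x|M. g x * K x) + (LINT y|M. G y * k y)"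
    using iA iB conv by simp
  also have "(LINT x|M. g x * K x) = (LINT x|M. LINT y|M. A x y)"
    by (rule Bochner_Integration.integral_cong) (auto simp: intA)
  also have "(LINT y|M. G y * k y) = (LINT y|M. LINT x|M. B x y)"
    by (rule Bochner_Integration.integral_cong) (auto simp: intB)
  also have "(LINT y|M. LINT x|M. B x y) = (LINT x|M. LINT y|M. B x y)"
    by (rule P.Fubini_integral[OF B])
  also have "(LINT x|M. LINT y|M. A x y) + (LINT x|M. LINT y|M. B x y)
     = (LINT z|(M \<Otimes>\<^sub>M M). case_prod A z) + (LINT z|(M \<Otimes>\<^sub>M M). case_prod B z)"
    using P.integral_fst[OF A] P.integral_fst[OF B] by simp
  also have "\<dots> = (LINT z|(M \<Otimes>\<^sub>M M). case_prod A z + case_prod B z)"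
    using A B by simp
  also have "\<dots> = (LINT z|(M \<Otimes>\<^sub>M M). (\<lambda>(x, y). g x * k y) z)"
    by (rule Bochner_Integration.integral_cong) (auto simp: A_def B_def)
  also have "\<dots> = (LINT x|M. LINT y|M. g x * k y)"
    using P.integral_fst[OF prod] by simp
  also have "\<dots> = G b * K b" using gM kM by (simp add: conv G_def K_def)
  finally show ?thesis .
qed

lemma absolutely_integrable_mult_continuous:
  fixes g w :: "real \<Rightarrow> complex"
  assumes g: "g absolutely_integrable_on {a..b}" and w: "continuous_on {a..b} w"
  shows "(\<lambda>x. g x * w x) absolutely_integrable_on {a..b}"
proof -
  have "(\<lambda>x. w x * g x) absolutely_integrable_on {a..b}"
  proof (rule absolutely_integrable_bounded_measurable_product[where h = "(*)"])
    show "w \<in> borel_measurable (lebesgue_on {a..b})"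
      using w by (rule continuous_imp_measurable_on_sets_lebesgue) auto
    show "bounded (w ` {a..b})" using w by (intro compact_imp_bounded compact_continuous_image) auto
  qed (use g bilinear_times in auto)
  then show ?thesis by (simp add: mult.commute)
qed

text \<open>The product rule, reduced to the previous lemma by splitting off the initial values.\<close>
lemma ac_mult:
  assumes \<phi>: "ac a b \<phi> g" and \<psi>: "ac a b \<psi> k"
  shows "ac a b (\<lambda>x. \<phi> x * \<psi> x) (\<lambda>x. g x * \<psi> x + \<phi> x * k x)"
proof -
  have gab: "g absolutely_integrable_on {a..b}" and kab: "k absolutely_integrable_on {a..b}"
    using \<phi> \<psi> by (auto dest: ac_absolutely_integrable)
  have int: "(\<lambda>x. g x * \<psi> x) absolutely_integrable_on {a..b}" "(\<lambda>x. \<phi> x * k x) absolutely_integrable_on {a..b}"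
    using absolutely_integrable_mult_continuous[OF gab ac_continuous[OF \<psi>]]
      absolutely_integrable_mult_continuous[OF kab ac_continuous[OF \<phi>]] by (auto simp: mult.commute)
  have "\<phi> x * \<psi> x = \<phi> a * \<psi> a + integral {a..x} (\<lambda>t. g t * \<psi> t + \<phi> t * k t)" if x: "x \<in> {a..b}" for x
  proof -
    define G where "G t = integral {a..t} g" for t
    define K where "K t = integral {a..t} k" for t
    have ax: "ac a x \<phi> g" "ac a x \<psi> k" using ac_subinterval[OF \<phi>, of a x] ac_subinterval[OF \<psi>, of a x] x by auto
    have g: "g absolutely_integrable_on {a..x}" and k: "k absolutely_integrable_on {a..x}"
      using ax by (auto dest: ac_absolutely_integrable)
    note gi = ac_integrable[OF ax(1) order_refl order_refl] and ki = ac_integrable[OF ax(2) order_refl order_refl]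
    have cont: "continuous_on {a..x} G" "continuous_on {a..x} K"
      unfolding G_def K_def using gi ki by (auto intro: indefinite_integral_continuous_1)
    have i1: "(\<lambda>t. g t * K t) integrable_on {a..x}" and i2: "(\<lambda>t. G t * k t) integrable_on {a..x}"
      using absolutely_integrable_mult_continuous[OF g cont(2)] absolutely_integrable_mult_continuous[OF k cont(1)]
      by (auto simp: mult.commute dest: set_lebesgue_integral_eq_integral(1))
    have e: "\<phi> t = \<phi> a + G t" "\<psi> t = \<psi> a + K t" if "t \<in> {a..x}" for t
      unfolding G_def K_def using ac_eq[OF ax(1) that] ac_eq[OF ax(2) that] .
    have "integral {a..x} (\<lambda>t. g t * \<psi> t + \<phi> t * k t)
        = integral {a..x} (\<lambda>t. (g t * \<psi> a + \<phi> a * k t) + (g t * K t + G t * k t))"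
    proof (rule integral_cong)
      fix t assume "t \<in> {a..x}"
      show "g t * \<psi> t + \<phi> t * k t = (g t * \<psi> a + \<phi> a * k t) + (g t * K t + G t * k t)"
        unfolding e[OF \<open>t \<in> {a..x}\<close>] by (simp add: algebra_simps)
    qed
    also have "\<dots> = (integral {a..x} g * \<psi> a + \<phi> a * integral {a..x} k)
        + (integral {a..x} (\<lambda>t. g t * K t) + integral {a..x} (\<lambda>t. G t * k t))"
      using gi ki i1 i2 by (subst Henstock_Kurzweil_Integration.integral_add; (intro integrable_add integrable_on_mult_left integrable_on_mult_right)?; simp?)+
    also have "\<dots> = G x * \<psi> a + \<phi> a * K x + G x * K x"
      using integral_mult_integral_swap[OF g k] by (simp add: G_def K_def)
    finally have eq: "integral {a..x} (\<lambda>t. g t * \<psi> t + \<phi> t * k t) = G x * \<psi> a + \<phi> a * K x + G x * K x" .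
    have "x \<in> {a..x}" using x by simp
    from e[OF this] show ?thesis unfolding eq by (simp add: algebra_simps)
  qed
  then show ?thesis unfolding ac_def using set_integral_add(1)[OF int] by blast
qed

lemma ac_integration_by_parts:
  assumes "ac a b \<phi> g" "ac a b \<psi> k" "a \<le> b"
  shows "integral {a..b} (\<lambda>x. g x * \<psi> x + \<phi> x * k x) = \<phi> b * \<psi> b - \<phi> a * \<psi> a"
proof -
  have "\<phi> b * \<psi> b = \<phi> a * \<psi> a + integral {a..b} (\<lambda>x. g x * \<psi> x + \<phi> x * k x)"
    by (rule ac_diff[OF ac_mult[OF assms(1,2)]]) (use assms(3) in auto)
  then show ?thesis by (subst eq_diff_eq) (simp only: add.commute)
qed

text \<open>Wirtinger's inequality by completing a square. The function \<open>q x = - s * tan (s * (x - m))\<close> is the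
logarithmic derivative of \<open>cos (s * (x - m))\<close> and solves the Riccati equation $q' = -s^2 - q^2$, so
\[ |g|^2 - s^2 |\varphi|^2 = |g - q\varphi|^2 + (q |\varphi|^2)', \]
and the boundary terms vanish. Staying strictly below the critical length keeps \<open>q\<close> bounded up to
the end points. The alternative \<open>a = m\<close>, where \<open>q a = 0\<close>, covers the Neumann condition at \<open>a\<close>.\<close>
lemma Wirtinger_tan:
  assumes ac: "ac a b \<phi> g" and "a \<le> b" and g2: "(\<lambda>x. (cmod (g x))\<^sup>2) integrable_on {a..b}"
    and small: "\<And>x. x \<in> {a..b} \<Longrightarrow> \<bar>s * (x - m)\<bar> < pi / 2"
    and "\<phi> b = 0" and "\<phi> a = 0 \<or> a = m"
  shows "s\<^sup>2 * integral {a..b} (\<lambda>x. (cmod (\<phi> x))\<^sup>2) \<le> integral {a..b} (\<lambda>x. (cmod (g x))\<^sup>2)"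
proof -
  define q where "q x = - s * tan (s * (x - m))" for x
  define q' where "q' x = - s\<^sup>2 - (q x)\<^sup>2" for x
  have cos: "cos (s * (x - m)) \<noteq> 0" if "x \<in> {a..b}" for x
  proof -
    have "0 < cos (s * (x - m))" using small[OF that] by (intro cos_gt_zero_pi) auto
    then show ?thesis by simp
  qed
  have deriv: "(q has_real_derivative q' x) (at x within {a..b})" if "x \<in> {a..b}" for x
  proof -
    have "(q has_real_derivative - s * (inverse ((cos (s * (x - m)))\<^sup>2) * s)) (at x within {a..b})"
      unfolding q_def using cos[OF that] by (auto intro!: derivative_eq_intros)
    also have "- s * (inverse ((cos (s * (x - m)))\<^sup>2) * s) = q' x"
      unfolding power_inverse[symmetric] tan_sec[OF cos[OF that], symmetric]
      by (simp add: q'_def q_def power2_eq_square algebra_simps)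
    finally show ?thesis .
  qed
  have contq: "continuous_on {a..b} q"
    using deriv by (meson DERIV_continuous continuous_on_eq_continuous_within)
  have acq: "ac a b (\<lambda>x. of_real (q x)) (\<lambda>x. of_real (q' x))"
  proof (rule ac_smooth[OF \<open>a \<le> b\<close>])
    show "((\<lambda>x. of_real (q x)) has_vector_derivative complex_of_real (q' x)) (at x within {a..b})"
      if "x \<in> {a..b}" for x
      using deriv[OF that] by (intro has_vector_derivative_of_real)
        (simp add: has_real_derivative_iff_has_vector_derivative)
    show "continuous_on {a..b} (\<lambda>x. complex_of_real (q' x))"
      unfolding q'_def using contq by (intro continuous_intros)
  qed
  define D where "D x = (g x * cnj (\<phi> x) + \<phi> x * cnj (g x)) * of_real (q x)
    + \<phi> x * cnj (\<phi> x) * of_real (q' x)" for x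
  have acD: "ac a b (\<lambda>x. \<phi> x * cnj (\<phi> x) * of_real (q x)) D"
    unfolding D_def by (rule ac_mult[OF ac_mult[OF ac ac_cnj[OF ac]] acq])
  have "\<phi> b * cnj (\<phi> b) * of_real (q b) = \<phi> a * cnj (\<phi> a) * of_real (q a) + integral {a..b} D"
    by (rule ac_diff[OF acD]) (use \<open>a \<le> b\<close> in auto)
  moreover have "\<phi> a * cnj (\<phi> a) * of_real (q a) = 0" using assms(6) by (auto simp: q_def)
  ultimately have "integral {a..b} D = 0" using \<open>\<phi> b = 0\<close> by simp
  then have D0: "((\<lambda>x. Re (D x)) has_integral 0) {a..b}"
    using has_integral_Re[OF integrable_integral[OF ac_integrable[OF acD order_refl order_refl]]] by simp
  have ptw: "Re (D x) + s\<^sup>2 * (cmod (\<phi> x))\<^sup>2 \<le> (cmod (g x))\<^sup>2" for x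
  proof -
    have "(cmod (g x))\<^sup>2 - (Re (D x) + s\<^sup>2 * (cmod (\<phi> x))\<^sup>2) = (cmod (g x - of_real (q x) * \<phi> x))\<^sup>2"
      unfolding cmod_power2 D_def q'_def by (simp add: power2_eq_square algebra_simps)
    then show ?thesis by (metis diff_ge_0_iff_ge zero_le_power2)
  qed
  have "continuous_on {a..b} (\<lambda>x. s\<^sup>2 * (cmod (\<phi> x))\<^sup>2)"
    using ac_continuous[OF ac] by (intro continuous_intros)
  then have i: "(\<lambda>x. s\<^sup>2 * (cmod (\<phi> x))\<^sup>2) integrable_on {a..b}" by (rule integrable_continuous_real)
  have "integral {a..b} (\<lambda>x. Re (D x) + s\<^sup>2 * (cmod (\<phi> x))\<^sup>2) \<le> integral {a..b} (\<lambda>x. (cmod (g x))\<^sup>2)"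
    using D0 i g2 ptw by (intro integral_le integrable_add) (auto simp: has_integral_iff)
  also have "integral {a..b} (\<lambda>x. Re (D x) + s\<^sup>2 * (cmod (\<phi> x))\<^sup>2) = s\<^sup>2 * integral {a..b} (\<lambda>x. (cmod (\<phi> x))\<^sup>2)"
    using D0 i by (subst Henstock_Kurzweil_Integration.integral_add) (auto simp: has_integral_iff)
  finally show ?thesis .
qed

section \<open>Square integrable functions\<close>

text \<open>The space $L^2$ of an arbitrary measure, because the norm estimates are needed on subintervals too.\<close>
definition sq_integrable :: "'b measure \<Rightarrow> ('b \<Rightarrow> complex) set" where
  "sq_integrable M = {f \<in> borel_measurable M. integrable M (\<lambda>x. (cmod (f x))\<^sup>2)}"

lemma L2_eq: "L2 L = sq_integrable (lebesgue_on {0..L})"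
  by (auto simp: L2_def sq_integrable_def)

lemma integrable_mult_cnj:
  assumes "f \<in> sq_integrable M" "g \<in> sq_integrable M"
  shows "integrable M (\<lambda>x. f x * cnj (g x))"
proof (rule Bochner_Integration.integrable_bound)
  show "integrable M (\<lambda>x. (cmod (f x))\<^sup>2 + (cmod (g x))\<^sup>2)"
    using assms by (auto simp: sq_integrable_def)
  show "(\<lambda>x. f x * cnj (g x)) \<in> borel_measurable M"
  proof (rule borel_measurable_times)
    have "g \<in> borel_measurable M" using assms by (simp add: sq_integrable_def)
    then show "(\<lambda>x. cnj (g x)) \<in> borel_measurable M"
      by (rule measurable_compose) (intro borel_measurable_continuous_onI continuous_intros)
  qed (use assms in \<open>simp add: sq_integrable_def\<close>)
  show "AE x in M. norm (f x * cnj (g x)) \<le> norm ((cmod (f x))\<^sup>2 + (cmod (g x))\<^sup>2)"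
  proof (intro AE_I2)
    fix x
    have "cmod (f x) * cmod (g x) \<le> (cmod (f x))\<^sup>2 + (cmod (g x))\<^sup>2"
      using sum_squares_bound[of "cmod (f x)" "cmod (g x)"]
        mult_nonneg_nonneg[OF norm_ge_zero norm_ge_zero, of "f x" "g x"] by linarith
    then show "norm (f x * cnj (g x)) \<le> norm ((cmod (f x))\<^sup>2 + (cmod (g x))\<^sup>2)"
      by (simp add: norm_mult)
  qed
qed

lemma cmod_add_square_le: "(cmod (a + b))\<^sup>2 \<le> 2 * (cmod a)\<^sup>2 + 2 * (cmod b)\<^sup>2"
proof -
  have "(cmod (a + b))\<^sup>2 \<le> (cmod a + cmod b)\<^sup>2" by (intro power_mono norm_triangle_ineq) auto
  also have "\<dots> \<le> 2 * (cmod a)\<^sup>2 + 2 * (cmod b)\<^sup>2"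
    using sum_squares_bound[of "cmod a" "cmod b"] by (simp add: power2_sum)
  finally show ?thesis .
qed

lemma sq_integrable_intros:
  shows sq_integrable_add: "f \<in> sq_integrable M \<Longrightarrow> g \<in> sq_integrable M \<Longrightarrow> (\<lambda>x. f x + g x) \<in> sq_integrable M"
    and sq_integrable_scale: "f \<in> sq_integrable M \<Longrightarrow> (\<lambda>x. c * f x) \<in> sq_integrable M"
    and sq_integrable_diff: "f \<in> sq_integrable M \<Longrightarrow> g \<in> sq_integrable M \<Longrightarrow> (\<lambda>x. f x - g x) \<in> sq_integrable M"
proof -
  show add: "(\<lambda>x. f x + g x) \<in> sq_integrable M" if "f \<in> sq_integrable M" "g \<in> sq_integrable M" for f g
    unfolding sq_integrable_def
  proof (intro CollectI conjI)
    show m: "(\<lambda>x. f x + g x) \<in> borel_measurable M"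
      using that by (auto simp: sq_integrable_def)
    show "integrable M (\<lambda>x. (cmod (f x + g x))\<^sup>2)"
    proof (rule Bochner_Integration.integrable_bound)
      show "integrable M (\<lambda>x. 2 * (cmod (f x))\<^sup>2 + 2 * (cmod (g x))\<^sup>2)"
        using that by (auto simp: sq_integrable_def)
      show "(\<lambda>x. (cmod (f x + g x))\<^sup>2) \<in> borel_measurable M" using m by measurable
      show "AE x in M. norm ((cmod (f x + g x))\<^sup>2) \<le> norm (2 * (cmod (f x))\<^sup>2 + 2 * (cmod (g x))\<^sup>2)"
        using cmod_add_square_le by (intro AE_I2) simp
    qed
  qed
  show scale: "(\<lambda>x. c * f x) \<in> sq_integrable M" if "f \<in> sq_integrable M" for c f
    using that by (auto simp: sq_integrable_def norm_mult power_mult_distrib)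
  show "(\<lambda>x. f x - g x) \<in> sq_integrable M" if "f \<in> sq_integrable M" "g \<in> sq_integrable M" for f g
    using add[OF that(1) scale[OF that(2), of "-1"]] by simp
qed

lemma (in finite_measure) integrable_sq_integrable:
  assumes "f \<in> sq_integrable M"
  shows "integrable M f"
proof -
  have "(\<lambda>x. 1) \<in> sq_integrable M" by (simp add: sq_integrable_def)
  from integrable_mult_cnj[OF assms this] show ?thesis by simp
qed

text \<open>The Cauchy-Schwarz inequality against the constant function 1.\<close>
lemma (in finite_measure) integral_norm_square_le:
  assumes f: "f \<in> sq_integrable M"
  shows "(LINT x|M. cmod (f x))\<^sup>2 \<le> measure M (space M) * (LINT x|M. (cmod (f x))\<^sup>2)"
proof -
  define I where "I = (LINT x|M. cmod (f x))"
  define J where "J = (LINT x|M. (cmod (f x))\<^sup>2)"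
  define m where "m = measure M (space M)"
  have i: "integrable M (\<lambda>x. cmod (f x))" "integrable M (\<lambda>x. (cmod (f x))\<^sup>2)"
    using integrable_sq_integrable[OF f] f by (auto simp: sq_integrable_def)
  have *: "0 \<le> J - 2 * t * I + t\<^sup>2 * m" for t
  proof -
    have "0 \<le> (LINT x|M. (cmod (f x) - t)\<^sup>2)" by (rule Bochner_Integration.integral_nonneg) simp
    also have "\<dots> = (LINT x|M. (cmod (f x))\<^sup>2 - 2 * t * cmod (f x) + t\<^sup>2)"
      by (rule Bochner_Integration.integral_cong) (auto simp: power2_diff)
    also have "\<dots> = J - 2 * t * I + t\<^sup>2 * m"
      using i by (simp add: I_def J_def m_def)
    finally show ?thesis .
  qed
  show ?thesis
  proof (cases "m = 0")
    case True
    have "I = 0"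
    proof (rule ccontr)
      assume "I \<noteq> 0"
      then show False using *[of "(J + 1) / (2 * I)"] True by simp
    qed
    then show ?thesis using True by (simp add: I_def m_def)
  next
    case False
    then have "m > 0" unfolding m_def by (simp add: zero_less_measure_iff)
    have "J - 2 * (I / m) * I + (I / m)\<^sup>2 * m = J - I\<^sup>2 / m"
      using \<open>m > 0\<close> by (simp add: power2_eq_square field_simps)
    then have "I\<^sup>2 / m \<le> J" using *[of "I / m"] by simp
    then have "I\<^sup>2 \<le> m * J" using \<open>m > 0\<close> by (simp add: field_simps)
    then show ?thesis by (simp only: I_def J_def m_def)
  qed
qed

text \<open>The Riesz-Fischer theorem on a finite measure space. There an $L^2$ Cauchy sequence is also Cauchy in
$L^1$ and so has an almost everywhere convergent subsequence; Fatou's lemma turns the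
pointwise limit into the $L^2$ limit.\<close>
theorem (in finite_measure) sq_integrable_complete:
  assumes f: "\<And>n::nat. f n \<in> sq_integrable M"
    and Cauchy: "\<And>e. e > 0 \<Longrightarrow> \<exists>N. \<forall>i\<ge>N. \<forall>j\<ge>N. (LINT x|M. (cmod (f i x - f j x))\<^sup>2) < e"
  obtains u where "u \<in> sq_integrable M" "(\<lambda>n. LINT x|M. (cmod (f n x - u x))\<^sup>2) \<longlonglongrightarrow> 0"
proof -
  define m where "m = measure M (space M)"
  have fm [measurable]: "f n \<in> borel_measurable M" for n using f by (simp add: sq_integrable_def)
  have L1: "\<exists>N. \<forall>i\<ge>N. \<forall>j\<ge>N. (LINT x|M. norm (f i x - f j x)) < e" if "e > 0" for e
  proof -
    have "e\<^sup>2 / (m + 1) > 0" using that measure_nonneg[of M "space M"] by (simp add: m_def add_nonneg_pos)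
    from Cauchy[OF this] obtain N where N: "\<And>i j. i \<ge> N \<Longrightarrow> j \<ge> N \<Longrightarrow> (LINT x|M. (cmod (f i x - f j x))\<^sup>2) < e\<^sup>2 / (m + 1)"
      by blast
    have "(LINT x|M. norm (f i x - f j x)) < e" if "i \<ge> N" "j \<ge> N" for i j
    proof -
      have m0: "0 \<le> m" by (simp add: m_def)
      have "(LINT x|M. norm (f i x - f j x))\<^sup>2 \<le> m * (LINT x|M. (cmod (f i x - f j x))\<^sup>2)"
        unfolding m_def by (rule integral_norm_square_le[OF sq_integrable_diff[OF f f]])
      also have "\<dots> \<le> m * (e\<^sup>2 / (m + 1))" using N[OF that] m0 by (intro mult_left_mono) auto
      also have "\<dots> < e\<^sup>2" using m0 \<open>e > 0\<close> by (simp add: field_simps)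
      finally show ?thesis using \<open>e > 0\<close> by (simp add: power2_less_imp_less)
    qed
    then show ?thesis by blast
  qed
  obtain r where r: "strict_mono r" and rC: "AE x in M. Cauchy (\<lambda>i. f (r i) x)"
    using cauchy_L1_AE_cauchy_subseq[of M f] integrable_sq_integrable[OF f] L1 by blast
  define u where "u x = lim (\<lambda>i. f (r i) x)" for x
  have um [measurable]: "u \<in> borel_measurable M" unfolding u_def by measurable
  have conv: "AE x in M. (\<lambda>i. f (r i) x) \<longlonglongrightarrow> u x"
    using rC by eventually_elim (simp add: u_def Cauchy_convergent_iff convergent_LIMSEQ_iff)
  have Fatou: "(\<integral>\<^sup>+x. ennreal ((cmod (f n x - u x))\<^sup>2) \<partial>M) \<le> ennreal e"
    if e: "\<forall>j\<ge>N. (LINT x|M. (cmod (f n x - f j x))\<^sup>2) < e" for n e N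
  proof -
    have "(\<integral>\<^sup>+x. ennreal ((cmod (f n x - u x))\<^sup>2) \<partial>M)
        = (\<integral>\<^sup>+x. liminf (\<lambda>i. ennreal ((cmod (f n x - f (r i) x))\<^sup>2)) \<partial>M)"
    proof (rule nn_integral_cong_AE)
      show "AE x in M. ennreal ((cmod (f n x - u x))\<^sup>2) = liminf (\<lambda>i. ennreal ((cmod (f n x - f (r i) x))\<^sup>2))"
        using conv
      proof eventually_elim
        fix x assume "(\<lambda>i. f (r i) x) \<longlonglongrightarrow> u x"
        then have "(\<lambda>i. ennreal ((cmod (f n x - f (r i) x))\<^sup>2)) \<longlonglongrightarrow> ennreal ((cmod (f n x - u x))\<^sup>2)"
          by (intro tendsto_ennrealI tendsto_intros)
        then show "ennreal ((cmod (f n x - u x))\<^sup>2) = liminf (\<lambda>i. ennreal ((cmod (f n x - f (r i) x))\<^sup>2))"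
          by (intro lim_imp_Liminf[symmetric]) auto
      qed
    qed
    also have "\<dots> \<le> liminf (\<lambda>i. \<integral>\<^sup>+x. ennreal ((cmod (f n x - f (r i) x))\<^sup>2) \<partial>M)"
      by (rule nn_integral_liminf) measurable
    also have "\<dots> \<le> liminf (\<lambda>i. ennreal e)"
    proof (rule Liminf_mono)
      have "(\<integral>\<^sup>+x. ennreal ((cmod (f n x - f (r i) x))\<^sup>2) \<partial>M) \<le> ennreal e" if "i \<ge> N" for i
      proof -
        have "(\<integral>\<^sup>+x. ennreal ((cmod (f n x - f (r i) x))\<^sup>2) \<partial>M) = ennreal (LINT x|M. (cmod (f n x - f (r i) x))\<^sup>2)"
          using sq_integrable_diff[OF f f, of n "r i"]
          by (intro nn_integral_eq_integral) (auto simp: sq_integrable_def)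
        also have "\<dots> \<le> ennreal e"
          using e seq_suble[OF r, of i] that by (intro ennreal_leI less_imp_le) auto
        finally show ?thesis .
      qed
      then show "\<forall>\<^sub>F i in sequentially. (\<integral>\<^sup>+x. ennreal ((cmod (f n x - f (r i) x))\<^sup>2) \<partial>M) \<le> ennreal e"
        by (auto simp: eventually_sequentially)
    qed
    also have "\<dots> = ennreal e" by (simp add: Liminf_const)
    finally show ?thesis .
  qed
  have diffL2: "(\<lambda>x. f n x - u x) \<in> sq_integrable M \<and> (LINT x|M. (cmod (f n x - u x))\<^sup>2) \<le> e"
    if "e > 0" "\<forall>j\<ge>N. (LINT x|M. (cmod (f n x - f j x))\<^sup>2) < e" for n e N
  proof -
    have le: "(\<integral>\<^sup>+x. ennreal ((cmod (f n x - u x))\<^sup>2) \<partial>M) \<le> ennreal e" by (rule Fatou[OF that(2)])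
    then have "(\<integral>\<^sup>+x. ennreal (norm ((cmod (f n x - u x))\<^sup>2)) \<partial>M) < \<infinity>"
      using le_less_trans[OF le ennreal_less_top] by simp
    then have i: "integrable M (\<lambda>x. (cmod (f n x - u x))\<^sup>2)"
      by (intro integrableI_bounded) measurable
    then have "ennreal (LINT x|M. (cmod (f n x - u x))\<^sup>2) \<le> ennreal e"
      using le by (subst nn_integral_eq_integral[symmetric]) auto
    then show ?thesis using i that(1) by (simp add: sq_integrable_def)
  qed
  have "u \<in> sq_integrable M"
  proof -
    obtain N where "\<forall>j\<ge>N. (LINT x|M. (cmod (f N x - f j x))\<^sup>2) < 1" using Cauchy[of 1] by auto
    from diffL2[OF _ this] have "(\<lambda>x. f N x - u x) \<in> sq_integrable M" by simp
    from sq_integrable_diff[OF f this, of N] show ?thesis by simp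
  qed
  moreover have "(\<lambda>n. LINT x|M. (cmod (f n x - u x))\<^sup>2) \<longlonglongrightarrow> 0"
  proof (rule LIMSEQ_I)
    fix e :: real assume "e > 0"
    then obtain N where N: "\<forall>i\<ge>N. \<forall>j\<ge>N. (LINT x|M. (cmod (f i x - f j x))\<^sup>2) < e / 2"
      using Cauchy[of "e / 2"] by auto
    have "norm ((LINT x|M. (cmod (f n x - u x))\<^sup>2) - 0) < e" if "n \<ge> N" for n
    proof -
      have "(LINT x|M. (cmod (f n x - u x))\<^sup>2) \<le> e / 2"
        using diffL2[of "e / 2" N n] N that \<open>e > 0\<close> by auto
      moreover have "0 \<le> (LINT x|M. (cmod (f n x - u x))\<^sup>2)" by simp
      ultimately show ?thesis using \<open>e > 0\<close> by simp
    qed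
    then show "\<exists>N. \<forall>n\<ge>N. norm ((LINT x|M. (cmod (f n x - u x))\<^sup>2) - 0) < e" by blast
  qed
  ultimately show ?thesis using that by blast
qed

section \<open>The Sobolev space on an interval\<close>

lemma integrable_lebesgue_on_iff:
  fixes f :: "real \<Rightarrow> complex"
  shows "S \<in> sets lebesgue \<Longrightarrow> integrable (lebesgue_on S) f \<longleftrightarrow> f absolutely_integrable_on S"
  by (simp add: set_integrable_def integrable_restrict_space)

text \<open>Half-lines form a generator of the Borel sets that is closed under intersection, so the integrals over
all measurable sets vanish as soon as those over half-lines do (a Dynkin system argument).\<close>
lemma AE_zero_if_primitive_zero:
  fixes d :: "real \<Rightarrow> complex"
  assumes d: "d absolutely_integrable_on {0..L}" and zero: "\<And>x. x \<in> {0..L} \<Longrightarrow> integral {0..x} d = 0"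
  shows "AE x in lebesgue_on {0..L}. d x = 0"
proof (cases "0 \<le> L")
  case False
  then show ?thesis by (simp add: AE_restrict_space_iff)
next
  case True
  define D where "D x = indicat_real {0..L} x *\<^sub>R d x" for x
  have Di: "integrable lebesgue D" using d unfolding D_def set_integrable_def .
  have setint: "set_integrable lebesgue A D" if "A \<in> sets lebesgue" for A
    unfolding set_integrable_def using that Di by (rule integrable_mult_indicator)
  have restrict: "set_lebesgue_integral lebesgue A D = set_lebesgue_integral lebesgue (A \<inter> {0..L}) d" for A
    by (simp add: set_lebesgue_integral_def D_def indicator_inter_arith)
  have atMost: "set_lebesgue_integral lebesgue {..x} D = 0" for x
  proof (cases "0 \<le> x")
    case False
    then have "{..x} \<inter> {0..L} = {}" by auto
    then show ?thesis unfolding restrict by (simp only: set_lebesgue_integral_def) simp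
  next
    case x: True
    have "{..x} \<inter> {0..L} = {0..min x L}" using x by auto
    moreover have "set_lebesgue_integral lebesgue {0..min x L} d = integral {0..min x L} d"
      by (rule set_lebesgue_integral_eq_integral(2), rule absolutely_integrable_on_subinterval[OF d]) auto
    ultimately show ?thesis using zero[of "min x L"] x True by (simp add: restrict)
  qed
  have total: "set_lebesgue_integral lebesgue UNIV D = 0"
  proof -
    have "UNIV \<inter> {0..L} = {..L} \<inter> {0..L}" by auto
    then show ?thesis using atMost[of L] by (simp only: restrict)
  qed
  have borel: "set_lebesgue_integral lebesgue A D = 0" if "A \<in> sets borel" for A
  proof -
    have gen: "sets borel = sigma_sets UNIV (range (\<lambda>a::real. {..a}))"
      by (subst borel_eq_atMost) simp
    have leb: "B \<in> sets lebesgue" if "B \<in> sigma_sets UNIV (range (\<lambda>a::real. {..a}))" for B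
      using that by (auto simp flip: gen)
    have "Int_stable (range (\<lambda>a::real. {..a}))" by (auto simp: Int_stable_def)
    moreover have "range (\<lambda>a::real. {..a}) \<subseteq> Pow UNIV" by simp
    moreover have "A \<in> sigma_sets UNIV (range (\<lambda>a::real. {..a}))" using that gen by simp
    ultimately show ?thesis
    proof (induction rule: sigma_sets_induct_disjoint)
      case (basic A)
      then show ?case using atMost by auto
    next
      case empty
      show ?case by (simp add: set_lebesgue_integral_def)
    next
      case (compl A)
      have "set_lebesgue_integral lebesgue UNIV D
          = set_lebesgue_integral lebesgue A D + set_lebesgue_integral lebesgue (UNIV - A) D"
        using set_integral_Un[of A "UNIV - A" lebesgue D] setint[OF leb[OF compl(1)]]
          setint[of "UNIV - A"] sets.compl_sets[OF leb[OF compl(1)]] by simp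
      then show ?case using compl total by simp
    next
      case (union A)
      have "set_lebesgue_integral lebesgue (\<Union>i. A i) D = (\<Sum>i. set_lebesgue_integral lebesgue (A i) D)"
        using union leb by (intro lebesgue_integral_countable_add setint) (auto simp: disjoint_family_on_def image_subset_iff)
      then show ?case using union by simp
    qed
  qed
  have "set_lebesgue_integral lebesgue A D = 0" if A: "A \<in> sets lebesgue" for A
  proof -
    obtain S N N' where S: "A = S \<union> N" "N \<subseteq> N'" "N' \<in> null_sets lborel" "S \<in> sets lborel"
      using A by (rule sets_completionE)
    have "AE x in lebesgue. x \<notin> N'"
      using S(3) by (auto intro: AE_not_in simp: null_sets_completionI)
    then have "AE x in lebesgue. x \<in> A \<longleftrightarrow> x \<in> S" by eventually_elim (use S in auto)
    then have "set_lebesgue_integral lebesgue A D = set_lebesgue_integral lebesgue S D"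
      using A S setint[of A] setint[of S] unfolding set_integrable_def
      by (intro set_integral_cong_set) (auto simp: set_borel_measurable_def)
    then show ?thesis using borel S by simp
  qed
  then have "set_lebesgue_integral (lebesgue_on {0..L}) A d = 0" if "A \<in> sets (lebesgue_on {0..L})" for A
    using that unfolding set_lebesgue_integral_def
    by (simp add: integral_restrict_space sets_restrict_space_iff D_def mult.commute)
  moreover interpret finite_measure "lebesgue_on {0..L}" by (rule finite_measure_lebesgue_on) auto
  have "integrable (lebesgue_on {0..L}) d" using d by (simp add: integrable_lebesgue_on_iff)
  ultimately show ?thesis by (intro density_zero) auto
qed

lemma is_H1_deriv_iff_ac: "is_H1_deriv L \<phi> g \<longleftrightarrow> g \<in> L2 L \<and> ac 0 L \<phi> g"
proof (cases "g \<in> L2 L")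
  case True
  interpret finite_measure "lebesgue_on {0..L}" by (rule finite_measure_lebesgue_on) auto
  have i: "g absolutely_integrable_on {0..L}"
    using integrable_sq_integrable[of g] True by (simp add: L2_eq integrable_lebesgue_on_iff)
  have "(LINT t|lebesgue_on {0..x}. g t) = integral {0..x} g" if "x \<in> {0..L}" for x
  proof (rule lebesgue_integral_eq_integral)
    show "integrable (lebesgue_on {0..x}) g"
      using absolutely_integrable_on_subinterval[OF i, of 0 x] that by (simp add: integrable_lebesgue_on_iff)
  qed simp
  then show ?thesis using i True by (simp add: is_H1_deriv_def ac_def)
qed (simp add: is_H1_deriv_def)

lemma is_H1_deriv_L2: "is_H1_deriv L \<phi> g \<Longrightarrow> g \<in> L2 L"
  by (simp add: is_H1_deriv_def)

lemma H1_deriv: "\<phi> \<in> H1 L \<Longrightarrow> is_H1_deriv L \<phi> (H1_deriv L \<phi>)"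
  unfolding H1_def H1_deriv_def by (auto intro: someI_ex[of "is_H1_deriv L \<phi>"])

lemma H1_derivE:
  assumes "\<phi> \<in> H1 L"
  obtains g where "is_H1_deriv L \<phi> g"
  using assms H1_deriv by blast

text \<open>Uniqueness of weak derivatives. It makes the arbitrary choice in \<open>H1_deriv\<close> harmless, and in
particular makes the form linear.\<close>
lemma is_H1_deriv_unique:
  assumes "is_H1_deriv L \<phi> g" "is_H1_deriv L \<phi> k"
  shows "AE x in lebesgue_on {0..L}. g x = k x"
proof -
  have g: "ac 0 L \<phi> g" and k: "ac 0 L \<phi> k" using assms by (auto simp: is_H1_deriv_iff_ac)
  have "AE x in lebesgue_on {0..L}. g x - k x = 0"
  proof (rule AE_zero_if_primitive_zero)
    show "(\<lambda>x. g x - k x) absolutely_integrable_on {0..L}"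
      using g k by (intro set_integral_diff(1) ac_absolutely_integrable)
    fix x assume x: "x \<in> {0..L}"
    then have "integral {0..x} g = integral {0..x} k"
      using ac_eq[OF g x] ac_eq[OF k x] by simp
    moreover have "g integrable_on {0..x}" "k integrable_on {0..x}"
      using x ac_integrable[OF g] ac_integrable[OF k] by auto
    ultimately show "integral {0..x} (\<lambda>x. g x - k x) = 0"
      by (simp add: Henstock_Kurzweil_Integration.integral_diff)
  qed
  then show ?thesis by eventually_elim simp
qed

lemma hermitian_form_L2: "hermitian_form (\<lambda>c f x. c * f x) (L2 L) (L2_inner L)"
proof (unfold_locales, unfold L2_eq)
  show "cfun.subspace (sq_integrable (lebesgue_on {0..L}))"
    by (rule cfun.subspaceI)
       (auto simp: plus_fun_def zero_fun_def intro: sq_integrable_add sq_integrable_scale, simp add: sq_integrable_def)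
  fix x y z assume *: "x \<in> sq_integrable (lebesgue_on {0..L})" "y \<in> sq_integrable (lebesgue_on {0..L})"
  {
    assume z: "z \<in> sq_integrable (lebesgue_on {0..L})"
    show "L2_inner L (x + y) z = L2_inner L x z + L2_inner L y z"
      using integrable_mult_cnj[OF *(1) z] integrable_mult_cnj[OF *(2) z]
      by (simp add: L2_inner_def distrib_right)
  }
  have "cnj (LINT t|lebesgue_on {0..L}. x t * cnj (y t)) = (LINT t|lebesgue_on {0..L}. cnj (x t * cnj (y t)))"
    by (rule Bochner_Integration.integral_cnj[symmetric])
  also have "\<dots> = (LINT t|lebesgue_on {0..L}. y t * cnj (x t))"
    by (rule Bochner_Integration.integral_cong) (auto simp: mult.commute)
  finally show "L2_inner L y x = cnj (L2_inner L x y)" by (simp add: L2_inner_def)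
next
  fix c x z assume "x \<in> sq_integrable (lebesgue_on {0..L})" "z \<in> sq_integrable (lebesgue_on {0..L})"
  show "L2_inner L (\<lambda>a. c * x a) z = c * L2_inner L x z"
    by (simp add: L2_inner_def mult.assoc)
next
  fix x assume "x \<in> sq_integrable (lebesgue_on {0..L})"
  show "0 \<le> Re (L2_inner L x x)"
  proof -
    have "L2_inner L x x = of_real (LINT t|lebesgue_on {0..L}. (cmod (x t))\<^sup>2)"
      by (simp add: L2_inner_def complex_norm_square[symmetric] del: of_real_power)
    then show ?thesis by simp
  qed
qed

interpretation L2: hermitian_form "\<lambda>c f x. c * f x" "L2 L" "L2_inner L" for L
  by (rule hermitian_form_L2)

lemma L2_Q: "L2.Q L f = (LINT t|lebesgue_on {0..L}. (cmod (f t))\<^sup>2)"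
proof -
  have "L2_inner L f f = of_real (LINT t|lebesgue_on {0..L}. (cmod (f t))\<^sup>2)"
    by (simp add: L2_inner_def complex_norm_square[symmetric] del: of_real_power)
  then show ?thesis by (simp add: L2.Q_def)
qed

lemma (in hermitian_form) restrict_subspace:
  assumes "subspace W" "W \<subseteq> V"
  shows "hermitian_form scale W s"
  by unfold_locales (use assms in \<open>auto simp: subset_iff intro: add_left scale_left hermitian nonneg\<close>)

lemma L2_norm_square_integrable:
  assumes "g \<in> L2 L" "0 \<le> a" "b \<le> L"
  shows "(\<lambda>x. (cmod (g x))\<^sup>2) integrable_on {a..b}"
    and "integral {a..b} (\<lambda>x. (cmod (g x))\<^sup>2) \<le> L2.Q L g"
    and "L2.Q L g = integral {0..L} (\<lambda>x. (cmod (g x))\<^sup>2)"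
proof -
  have i: "integrable (lebesgue_on {0..L}) (\<lambda>x. (cmod (g x))\<^sup>2)" using assms by (simp add: L2_def)
  then show eq: "L2.Q L g = integral {0..L} (\<lambda>x. (cmod (g x))\<^sup>2)"
    unfolding L2_Q by (rule lebesgue_integral_eq_integral) simp
  have *: "(\<lambda>x. (cmod (g x))\<^sup>2) integrable_on {0..L}"
    using i by (rule integrable_on_lebesgue_on) simp
  then show ab: "(\<lambda>x. (cmod (g x))\<^sup>2) integrable_on {a..b}"
    by (rule integrable_subinterval_real) (use assms in auto)
  show "integral {a..b} (\<lambda>x. (cmod (g x))\<^sup>2) \<le> L2.Q L g"
    unfolding eq by (rule integral_subset_le[OF _ ab *]) (use assms in auto)
qed

text \<open>The embedding of $H^1$ into the Hoelder class of exponent one half; it provides the equicontinuity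
needed for compactness.\<close>
lemma H1_Holder:
  assumes "is_H1_deriv L \<phi> g" "0 \<le> x" "x \<le> y" "y \<le> L"
  shows "(cmod (\<phi> y - \<phi> x))\<^sup>2 \<le> (y - x) * L2.Q L g"
proof -
  interpret finite_measure "lebesgue_on {x..y}" by (rule finite_measure_lebesgue_on) auto
  have g: "g \<in> L2 L" and ac: "ac 0 L \<phi> g" using assms by (auto simp: is_H1_deriv_iff_ac)
  have ac': "ac x y \<phi> g" using ac assms by (intro ac_subinterval[OF ac]) auto
  have gxy: "integrable (lebesgue_on {x..y}) g"
    using ac_absolutely_integrable[OF ac'] by (simp add: integrable_lebesgue_on_iff)
  have g2: "integrable (lebesgue_on {x..y}) (\<lambda>t. (cmod (g t))\<^sup>2)"
    using L2_norm_square_integrable(1)[OF g assms(2,4)]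
    by (intro absolutely_integrable_imp_integrable nonnegative_absolutely_integrable_1) auto
  have "\<phi> y - \<phi> x = integral {x..y} g" using ac_diff[OF ac assms(2-4)] by (simp only: add_diff_cancel_left')
  also have "\<dots> = (LINT t|lebesgue_on {x..y}. g t)"
    using gxy by (simp add: lebesgue_integral_eq_integral)
  finally have "(cmod (\<phi> y - \<phi> x))\<^sup>2 \<le> (LINT t|lebesgue_on {x..y}. cmod (g t))\<^sup>2"
    by (intro power_mono) auto
  also have "\<dots> \<le> measure (lebesgue_on {x..y}) (space (lebesgue_on {x..y})) * (LINT t|lebesgue_on {x..y}. (cmod (g t))\<^sup>2)"
    using gxy g2 by (intro integral_norm_square_le) (auto simp: sq_integrable_def)
  also have "measure (lebesgue_on {x..y}) (space (lebesgue_on {x..y})) = y - x"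
    using assms by (simp add: measure_restrict_space)
  also have "(LINT t|lebesgue_on {x..y}. (cmod (g t))\<^sup>2) = integral {x..y} (\<lambda>t. (cmod (g t))\<^sup>2)"
    using g2 by (simp add: lebesgue_integral_eq_integral)
  also have "(y - x) * \<dots> \<le> (y - x) * L2.Q L g"
    using assms L2_norm_square_integrable(2)[OF g assms(2,4)] by (intro mult_left_mono) auto
  finally show ?thesis .
qed

lemma H1_continuous: "is_H1_deriv L \<phi> g \<Longrightarrow> continuous_on {0..L} \<phi>"
  by (auto simp: is_H1_deriv_iff_ac intro: ac_continuous)

lemma continuous_imp_L2:
  assumes "continuous_on {0..L} \<phi>"
  shows "\<phi> \<in> L2 L"
  unfolding L2_def
proof (intro CollectI conjI)
  show "\<phi> \<in> borel_measurable (lebesgue_on {0..L})"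
    using assms by (rule continuous_imp_measurable_on_sets_lebesgue) auto
  show "integrable (lebesgue_on {0..L}) (\<lambda>x. (cmod (\<phi> x))\<^sup>2)"
    using assms by (intro continuous_imp_integrable_real continuous_intros)
qed

lemma H1_imp_L2: "\<phi> \<in> H1 L \<Longrightarrow> \<phi> \<in> L2 L"
  by (rule continuous_imp_L2[OF H1_continuous[OF H1_deriv]])

text \<open>Average over \<open>y\<close> the estimate of \<open>\<phi> x\<close> in terms of \<open>\<phi> y\<close> and the increment between \<open>x\<close> and \<open>y\<close>.\<close>
lemma H1_sup_bound:
  assumes "is_H1_deriv L \<phi> g" "L > 0" "x \<in> {0..L}"
  shows "(cmod (\<phi> x))\<^sup>2 \<le> 2 / L * L2.Q L \<phi> + 2 * L * L2.Q L g"
proof -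
  define G where "G = L2.Q L g"
  have G: "0 \<le> G" unfolding G_def L2_Q by simp
  have \<phi>L2: "\<phi> \<in> L2 L" using assms by (intro continuous_imp_L2 H1_continuous)
  have "(cmod (\<phi> x))\<^sup>2 \<le> 2 * (cmod (\<phi> y))\<^sup>2 + 2 * (L * G)" if y: "y \<in> {0..L}" for y
  proof -
    have "(cmod (\<phi> y + (\<phi> x - \<phi> y)))\<^sup>2 \<le> 2 * (cmod (\<phi> y))\<^sup>2 + 2 * (cmod (\<phi> x - \<phi> y))\<^sup>2"
      by (rule cmod_add_square_le)
    moreover have "(cmod (\<phi> x - \<phi> y))\<^sup>2 \<le> \<bar>x - y\<bar> * G"
      using H1_Holder[OF assms(1), of x y] H1_Holder[OF assms(1), of y x] assms(3) y
      by (cases "x \<le> y") (auto simp: G_def norm_minus_commute)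
    moreover have "\<bar>x - y\<bar> * G \<le> L * G" using assms(3) y G by (intro mult_right_mono) auto
    ultimately show ?thesis by simp
  qed
  then have "integral {0..L} (\<lambda>y. (cmod (\<phi> x))\<^sup>2) \<le> integral {0..L} (\<lambda>y. 2 * (cmod (\<phi> y))\<^sup>2 + 2 * (L * G))"
    using L2_norm_square_integrable(1)[OF \<phi>L2, of 0 L]
    by (intro integral_le integrable_add integrable_on_mult_right integrable_const_ivl) auto
  also have "\<dots> = 2 * L2.Q L \<phi> + 2 * (L * G) * L"
    using L2_norm_square_integrable(1,3)[OF \<phi>L2, of 0 L] \<open>L > 0\<close>
    by (subst Henstock_Kurzweil_Integration.integral_add) auto
  finally have "L * (cmod (\<phi> x))\<^sup>2 \<le> L * (2 / L * L2.Q L \<phi> + 2 * L * G)"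
    using \<open>L > 0\<close> by (simp add: algebra_simps)
  then show ?thesis using \<open>L > 0\<close> by (simp add: G_def)
qed

lemma L2_Q_le_sup:
  assumes "\<phi> \<in> L2 L" "L > 0" "\<And>x. x \<in> {0..L} \<Longrightarrow> (cmod (\<phi> x))\<^sup>2 \<le> B"
  shows "L2.Q L \<phi> \<le> L * B"
proof -
  have "L2.Q L \<phi> = integral {0..L} (\<lambda>x. (cmod (\<phi> x))\<^sup>2)"
    using L2_norm_square_integrable(3)[OF assms(1), of 0 L] by simp
  also have "\<dots> \<le> integral {0..L} (\<lambda>x. B)"
    using L2_norm_square_integrable(1)[OF assms(1), of 0 L] assms by (intro integral_le integrable_const_ivl) auto
  finally show ?thesis using \<open>L > 0\<close> by simp
qed

lemma ac_lincomb:
  assumes \<phi>: "ac a b \<phi> g" and \<psi>: "ac a b \<psi> k"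
  shows "ac a b (\<lambda>x. c * \<phi> x + d * \<psi> x) (\<lambda>x. c * g x + d * k x)"
proof -
  have "c * \<phi> x + d * \<psi> x = (c * \<phi> a + d * \<psi> a) + integral {a..x} (\<lambda>t. c * g t + d * k t)"
    if x: "x \<in> {a..b}" for x
  proof -
    have "g integrable_on {a..x}" "k integrable_on {a..x}"
      using x ac_integrable[OF \<phi>] ac_integrable[OF \<psi>] by auto
    then have "integral {a..x} (\<lambda>t. c * g t + d * k t) = c * integral {a..x} g + d * integral {a..x} k"
      by (subst Henstock_Kurzweil_Integration.integral_add) (auto intro: integrable_on_mult_right)
    then show ?thesis using arg_cong2[OF ac_eq[OF \<phi> x] ac_eq[OF \<psi> x], of "\<lambda>u v. c * u + d * v"]
      by (simp add: algebra_simps)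
  qed
  moreover have "(\<lambda>x. c * g x + d * k x) absolutely_integrable_on {a..b}"
    using ac_absolutely_integrable[OF \<phi>] ac_absolutely_integrable[OF \<psi>]
    by (intro set_integral_add(1) set_integrable_mult_right impI)
  ultimately show ?thesis unfolding ac_def by blast
qed

lemma is_H1_deriv_lincomb:
  assumes "is_H1_deriv L \<phi> g" "is_H1_deriv L \<psi> k"
  shows "is_H1_deriv L (\<lambda>x. c * \<phi> x + d * \<psi> x) (\<lambda>x. c * g x + d * k x)"
  using assms by (auto simp: is_H1_deriv_iff_ac L2_eq intro: ac_lincomb sq_integrable_add sq_integrable_scale)

lemma is_H1_deriv_add:
  "is_H1_deriv L \<phi> g \<Longrightarrow> is_H1_deriv L \<psi> k \<Longrightarrow> is_H1_deriv L (\<phi> + \<psi>) (g + k)"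
  using is_H1_deriv_lincomb[of L \<phi> g \<psi> k 1 1] by (simp add: plus_fun_def)

lemma is_H1_deriv_diff:
  "is_H1_deriv L \<phi> g \<Longrightarrow> is_H1_deriv L \<psi> k \<Longrightarrow> is_H1_deriv L (\<phi> - \<psi>) (g - k)"
  using is_H1_deriv_lincomb[of L \<phi> g \<psi> k 1 "-1"] by (simp add: fun_diff_def)

lemma is_H1_deriv_scale:
  "is_H1_deriv L \<phi> g \<Longrightarrow> is_H1_deriv L (\<lambda>x. c * \<phi> x) (\<lambda>x. c * g x)"
  using is_H1_deriv_lincomb[of L \<phi> g \<phi> g c 0] by simp

lemma subspace_H1: "cfun.subspace (H1 L)"
proof (rule cfun.subspaceI)
  have "is_H1_deriv L (\<lambda>x. 0) (\<lambda>x. 0)"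
    by (simp add: is_H1_deriv_def L2_def)
  then show "0 \<in> H1 L" by (auto simp: H1_def zero_fun_def)
qed (auto simp: H1_def intro: is_H1_deriv_add is_H1_deriv_scale)

lemma L2_inner_cong_AE:
  assumes "AE x in lebesgue_on {0..L}. f x = f' x" "AE x in lebesgue_on {0..L}. g x = g' x"
    and "f \<in> L2 L" "f' \<in> L2 L" "g \<in> L2 L" "g' \<in> L2 L"
  shows "L2_inner L f g = L2_inner L f' g'"
  unfolding L2_inner_def
proof (rule integral_cong_AE)
  show "AE x in lebesgue_on {0..L}. f x * cnj (g x) = f' x * cnj (g' x)"
    using assms(1,2) by eventually_elim simp
qed (use assms integrable_mult_cnj in \<open>auto simp: L2_eq intro: borel_measurable_integrable\<close>)

lemma L2_inner_H1_deriv: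
  assumes "is_H1_deriv L \<phi> g" "is_H1_deriv L \<psi> k"
  shows "L2_inner L (H1_deriv L \<phi>) (H1_deriv L \<psi>) = L2_inner L g k"
proof -
  have d: "is_H1_deriv L \<phi> (H1_deriv L \<phi>)" "is_H1_deriv L \<psi> (H1_deriv L \<psi>)"
    using assms unfolding H1_deriv_def by (metis someI_ex)+
  show ?thesis
    by (rule L2_inner_cong_AE[OF is_H1_deriv_unique[OF d(1) assms(1)] is_H1_deriv_unique[OF d(2) assms(2)]])
       (use assms d in \<open>auto intro: is_H1_deriv_L2\<close>)
qed

section \<open>The form with point interactions\<close>

locale delta_setting =
  fixes L :: real and v \<sigma> :: "nat \<Rightarrow> real"
  assumes L_pos: "L > 0" and v_mono: "strict_mono v" and v_range: "\<And>n. v n \<in> {0..<L}"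
    and \<sigma>_nonneg: "\<And>n. 0 \<le> \<sigma> n"
begin

abbreviation "V \<equiv> form_domain L v \<sigma>"
abbreviation "dform \<equiv> delta_form L v \<sigma>"

lemma V_H1: "\<phi> \<in> V \<Longrightarrow> \<phi> \<in> H1 L"
  and V_summable: "\<phi> \<in> V \<Longrightarrow> summable (\<lambda>n. \<sigma> n * (cmod (\<phi> (v n)))\<^sup>2)"
  by (simp_all add: form_domain_def)

lemma V_L2: "\<phi> \<in> V \<Longrightarrow> \<phi> \<in> L2 L"
  by (simp add: V_H1 H1_imp_L2)

lemma V_deriv: "\<phi> \<in> V \<Longrightarrow> is_H1_deriv L \<phi> (H1_deriv L \<phi>)"
  by (simp add: V_H1 H1_deriv)

lemma summable_cross:
  assumes "\<phi> \<in> V" "\<psi> \<in> V"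
  shows "summable (\<lambda>n. of_real (\<sigma> n) * \<phi> (v n) * cnj (\<psi> (v n)))"
proof (rule summable_comparison_test')
  show "summable (\<lambda>n. \<sigma> n * (cmod (\<phi> (v n)))\<^sup>2 + \<sigma> n * (cmod (\<psi> (v n)))\<^sup>2)"
    using assms by (intro summable_add V_summable)
  fix n :: nat
  have "cmod (\<phi> (v n)) * cmod (\<psi> (v n)) \<le> (cmod (\<phi> (v n)))\<^sup>2 + (cmod (\<psi> (v n)))\<^sup>2"
    using sum_squares_bound[of "cmod (\<phi> (v n))" "cmod (\<psi> (v n))"]
      mult_nonneg_nonneg[OF norm_ge_zero norm_ge_zero, of "\<phi> (v n)" "\<psi> (v n)"] by linarith
  from mult_left_mono[OF this \<sigma>_nonneg[of n]]
  show "norm (of_real (\<sigma> n) * \<phi> (v n) * cnj (\<psi> (v n)))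
      \<le> \<sigma> n * (cmod (\<phi> (v n)))\<^sup>2 + \<sigma> n * (cmod (\<psi> (v n)))\<^sup>2"
    using \<sigma>_nonneg[of n] by (simp add: norm_mult distrib_left mult.assoc)
qed

lemma subspace_V: "cfun.subspace V"
proof (rule cfun.subspaceI)
  show "0 \<in> V" using cfun.subspace_0[OF subspace_H1] by (simp add: form_domain_def)
  fix \<phi> assume \<phi>: "\<phi> \<in> V"
  show "(\<lambda>x. c * \<phi> x) \<in> V" for c
    using cfun.subspace_scale[OF subspace_H1 V_H1[OF \<phi>], of c] summable_mult[OF V_summable[OF \<phi>], of "(cmod c)\<^sup>2"]
    by (simp add: form_domain_def norm_mult power_mult_distrib mult.left_commute)
  fix \<psi> assume \<psi>: "\<psi> \<in> V"
  have "summable (\<lambda>n. \<sigma> n * (cmod (\<phi> (v n) + \<psi> (v n)))\<^sup>2)"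
  proof (rule summable_comparison_test')
    show "summable (\<lambda>n. 2 * (\<sigma> n * (cmod (\<phi> (v n)))\<^sup>2) + 2 * (\<sigma> n * (cmod (\<psi> (v n)))\<^sup>2))"
      using \<phi> \<psi> by (intro summable_add summable_mult V_summable)
    show "norm (\<sigma> n * (cmod (\<phi> (v n) + \<psi> (v n)))\<^sup>2)
        \<le> 2 * (\<sigma> n * (cmod (\<phi> (v n)))\<^sup>2) + 2 * (\<sigma> n * (cmod (\<psi> (v n)))\<^sup>2)" for n
      using mult_left_mono[OF cmod_add_square_le \<sigma>_nonneg[of n], of "\<phi> (v n)" "\<psi> (v n)"] \<sigma>_nonneg[of n]
      by (simp add: algebra_simps)
  qed
  then show "\<phi> + \<psi> \<in> V"
    using cfun.subspace_add[OF subspace_H1 V_H1[OF \<phi>] V_H1[OF \<psi>]] by (simp add: form_domain_def)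
qed

sublocale ip: hermitian_form "\<lambda>c f x. c * f x" V "L2_inner L"
  by (rule L2.restrict_subspace[OF subspace_V]) (auto intro: V_L2)

text \<open>Positivity of the form, its domination of the Dirichlet integral and the closedness argument all
start from this splitting.\<close>
lemma dform_diagonal:
  assumes x: "x \<in> V"
  shows "dform x x = of_real (L2.Q L (H1_deriv L x) + (\<Sum>n. \<sigma> n * (cmod (x (v n)))\<^sup>2))"
proof -
  have "L2_inner L (H1_deriv L x) (H1_deriv L x) = of_real (L2.Q L (H1_deriv L x))"
    using V_deriv[OF x] by (intro L2.diagonal) (auto intro: is_H1_deriv_L2)
  moreover have "(\<Sum>n. of_real (\<sigma> n) * x (v n) * cnj (x (v n))) = (\<Sum>n. of_real (\<sigma> n * (cmod (x (v n)))\<^sup>2))"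
    by (simp add: complex_norm_square mult.assoc del: of_real_power)
  ultimately show ?thesis
    by (simp add: delta_form_def suminf_of_real[OF V_summable[OF x]] del: of_real_mult of_real_power)
qed

sublocale h: hermitian_form "\<lambda>c f x. c * f x" V dform
proof (unfold_locales, rule subspace_V)
  fix x y z assume x: "x \<in> V" and z: "z \<in> V"
  {
    assume y: "y \<in> V"
    have "L2_inner L (H1_deriv L (x + y)) (H1_deriv L z) = L2_inner L (H1_deriv L x + H1_deriv L y) (H1_deriv L z)"
      by (intro L2_inner_H1_deriv is_H1_deriv_add V_deriv x y z)
    also have "\<dots> = L2_inner L (H1_deriv L x) (H1_deriv L z) + L2_inner L (H1_deriv L y) (H1_deriv L z)"
      using V_deriv[OF x] V_deriv[OF y] V_deriv[OF z] by (intro L2.add_left) (auto intro: is_H1_deriv_L2)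
    finally show "dform (x + y) z = dform x z + dform y z"
      using suminf_add[OF summable_cross[OF x z] summable_cross[OF y z]]
      by (simp add: delta_form_def algebra_simps)
  }
  have "L2_inner L (H1_deriv L (\<lambda>t. c * x t)) (H1_deriv L z) = L2_inner L (\<lambda>t. c * H1_deriv L x t) (H1_deriv L z)" for c
    by (intro L2_inner_H1_deriv is_H1_deriv_scale V_deriv x z)
  also have "\<dots> c = c * L2_inner L (H1_deriv L x) (H1_deriv L z)" for c
    using V_deriv[OF x] V_deriv[OF z] by (intro L2.scale_left) (auto intro: is_H1_deriv_L2)
  finally show "dform (\<lambda>t. c * x t) z = c * dform x z" for c
    using suminf_mult[OF summable_cross[OF x z], of c]
    by (simp add: delta_form_def algebra_simps)
  have "cnj (\<Sum>n. of_real (\<sigma> n) * x (v n) * cnj (z (v n))) = (\<Sum>n. cnj (of_real (\<sigma> n) * x (v n) * cnj (z (v n))))"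
    by (rule bounded_linear.suminf[OF bounded_linear_cnj summable_cross[OF x z]])
  moreover have "L2_inner L (H1_deriv L z) (H1_deriv L x) = cnj (L2_inner L (H1_deriv L x) (H1_deriv L z))"
    using V_deriv[OF x] V_deriv[OF z] by (intro L2.hermitian) (auto intro: is_H1_deriv_L2)
  ultimately show "dform z x = cnj (dform x z)"
    by (simp add: delta_form_def mult.assoc mult.left_commute mult.commute)
  have "0 \<le> L2.Q L (H1_deriv L x)" by (simp add: L2_Q)
  moreover have "0 \<le> (\<Sum>n. \<sigma> n * (cmod (x (v n)))\<^sup>2)"
    using \<sigma>_nonneg by (intro suminf_nonneg V_summable x) auto
  ultimately show "0 \<le> Re (dform x x)" by (simp add: dform_diagonal[OF x])
qed

lemma h_Q:
  assumes "x \<in> V"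
  shows "h.Q x = L2.Q L (H1_deriv L x) + (\<Sum>n. \<sigma> n * (cmod (x (v n)))\<^sup>2)"
  by (simp add: h.Q_def dform_diagonal[OF assms])

text \<open>Dropping the point interactions only lowers the energy; their effect on the eigenvalues is
captured by the boundary condition at \<open>L\<close> that they enforce on the form domain.\<close>
lemma deriv_Q_le_h_Q:
  assumes "x \<in> V"
  shows "L2.Q L (H1_deriv L x) \<le> h.Q x"
  using suminf_nonneg[OF V_summable[OF assms]] \<sigma>_nonneg by (simp add: h_Q[OF assms])

end

section \<open>Compactness and completeness of the Sobolev space\<close>

lemma H1_deriv_Q: "is_H1_deriv L \<phi> g \<Longrightarrow> L2.Q L (H1_deriv L \<phi>) = L2.Q L g"
  by (simp add: L2.Q_def L2_inner_H1_deriv)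

lemma H1_definite:
  assumes "\<phi> \<in> H1 L" "L > 0" "L2.Q L \<phi> = 0"
  shows "\<phi> = 0"
proof
  fix x
  have cont: "continuous_on {0..L} \<phi>" using assms H1_continuous H1_deriv by blast
  have "integral {0..L} (\<lambda>x. (cmod (\<phi> x))\<^sup>2) = 0"
    using L2_norm_square_integrable(3)[OF H1_imp_L2[OF assms(1)], of 0 L] assms by simp
  then have "\<forall>x\<in>{0..L}. (cmod (\<phi> x))\<^sup>2 = 0"
    using cont \<open>L > 0\<close> by (subst (asm) integral_eq_0_iff) (auto intro!: continuous_intros)
  then show "\<phi> x = 0 x" using assms(1) by (cases "x \<in> {0..L}") (auto simp: H1_def)
qed

text \<open>The compact embedding of $H^1$ into $L^2$, through the Arzela-Ascoli theorem.\<close>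
lemma H1_bounded_imp_Cauchy_subsequence:
  assumes "L > 0" and X: "\<And>n::nat. is_H1_deriv L (X n) (G n)"
    and B: "\<And>n. L2.Q L (X n) \<le> B" "\<And>n. L2.Q L (G n) \<le> B"
  obtains r :: "nat \<Rightarrow> nat" where "strict_mono r"
    "\<And>\<epsilon>. \<epsilon> > 0 \<Longrightarrow> \<exists>M. \<forall>i\<ge>M. \<forall>j\<ge>M. L2.Q L (X (r i) - X (r j)) < \<epsilon>"
proof -
  define C where "C = 2 / L * B + 2 * L * B"
  have B0: "B \<ge> 0" using B(1)[of 0] by (simp add: L2_Q) (meson Bochner_Integration.integral_nonneg order_trans zero_le_power2)
  have bound: "norm (X n x) \<le> sqrt C" if "x \<in> {0..L}" for n x
  proof -
    have "(cmod (X n x))\<^sup>2 \<le> 2 / L * L2.Q L (X n) + 2 * L * L2.Q L (G n)"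
      using H1_sup_bound[OF X \<open>L > 0\<close> that] .
    also have "\<dots> \<le> C" unfolding C_def using B \<open>L > 0\<close> by (intro add_mono mult_left_mono) auto
    finally show ?thesis by (simp add: real_le_rsqrt)
  qed
  have equi: "\<exists>d>0. \<forall>n y. y \<in> {0..L} \<and> norm (x - y) < d \<longrightarrow> norm (X n x - X n y) < e"
    if x: "x \<in> {0..L}" and e: "0 < e" for x e
  proof (intro exI conjI allI impI)
    show "0 < e\<^sup>2 / (B + 1)" using e B0 by simp
    fix n y assume y: "y \<in> {0..L} \<and> norm (x - y) < e\<^sup>2 / (B + 1)"
    have "(norm (X n x - X n y))\<^sup>2 \<le> \<bar>x - y\<bar> * L2.Q L (G n)"
      using H1_Holder[OF X, of x y n] H1_Holder[OF X, of y x n] x y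
      by (cases "x \<le> y") (auto simp: norm_minus_commute)
    also have "\<dots> \<le> \<bar>x - y\<bar> * (B + 1)" using B(2)[of n] by (intro mult_left_mono) auto
    also have "\<dots> < e\<^sup>2 / (B + 1) * (B + 1)" using y B0 by (intro mult_strict_right_mono) auto
    also have "\<dots> = e\<^sup>2" using B0 by simp
    finally show "norm (X n x - X n y) < e" using e by (simp add: power2_less_imp_less)
  qed
  obtain g r where r: "strict_mono (r :: nat \<Rightarrow> nat)"
    and unif: "\<And>e. 0 < e \<Longrightarrow> \<exists>N. \<forall>n x. n \<ge> N \<and> x \<in> {0..L} \<longrightarrow> norm (X (r n) x - g x) < e"
    by (rule Arzela_Ascoli[of "{0..L}" X "sqrt C"]) (use bound equi in auto)
  have "\<exists>M. \<forall>i\<ge>M. \<forall>j\<ge>M. L2.Q L (X (r i) - X (r j)) < \<epsilon>" if "\<epsilon> > 0" for \<epsilon>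
  proof -
    define d where "d = sqrt (\<epsilon> / (8 * L))"
    have d: "d > 0" "d\<^sup>2 = \<epsilon> / (8 * L)" using that \<open>L > 0\<close> by (auto simp: d_def)
    obtain N where N: "\<And>n x. n \<ge> N \<Longrightarrow> x \<in> {0..L} \<Longrightarrow> norm (X (r n) x - g x) < d"
      using unif[OF d(1)] by blast
    have "L2.Q L (X (r i) - X (r j)) < \<epsilon>" if "i \<ge> N" "j \<ge> N" for i j
    proof -
      have "(cmod ((X (r i) - X (r j)) x))\<^sup>2 \<le> \<epsilon> / (2 * L)" if x: "x \<in> {0..L}" for x
      proof -
        have "norm (X (r i) x - X (r j) x) \<le> norm (X (r i) x - g x) + norm (X (r j) x - g x)"
          using norm_triangle_ineq4[of "X (r i) x - g x" "X (r j) x - g x"] by simp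
        also have "\<dots> \<le> 2 * d" using N[OF \<open>i \<ge> N\<close> x] N[OF \<open>j \<ge> N\<close> x] by simp
        finally have "(norm (X (r i) x - X (r j) x))\<^sup>2 \<le> (2 * d)\<^sup>2" by (intro power_mono) auto
        also have "\<dots> = \<epsilon> / (2 * L)" using d(2) by (simp add: power_mult_distrib)
        finally show ?thesis by simp
      qed
      then have "L2.Q L (X (r i) - X (r j)) \<le> L * (\<epsilon> / (2 * L))"
        using \<open>L > 0\<close> H1_continuous[OF is_H1_deriv_diff[OF X X]]
        by (intro L2_Q_le_sup continuous_imp_L2) auto
      also have "\<dots> < \<epsilon>" using \<open>L > 0\<close> \<open>\<epsilon> > 0\<close> by simp
      finally show ?thesis .
    qed
    then show ?thesis by blast
  qed
  then show ?thesis using that r by blast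
qed

text \<open>Completeness of $H^1$: integrate the $L^2$ limit of the derivatives, starting from the limit of the
values at 0. Convergence at every point is recorded because the form also contains point
evaluations.\<close>
lemma H1_complete:
  assumes "L > 0" and X: "\<And>n::nat. is_H1_deriv L (X n) (G n)"
    and Cauchy: "\<And>\<epsilon>. \<epsilon> > 0 \<Longrightarrow> \<exists>M. \<forall>i\<ge>M. \<forall>j\<ge>M. L2.Q L (X i - X j) < \<epsilon> \<and> L2.Q L (G i - G j) < \<epsilon>"
  obtains \<phi> u where "is_H1_deriv L \<phi> u" "\<phi> \<in> H1 L" "(\<lambda>n. L2.Q L (G n - u)) \<longlonglongrightarrow> 0"
    "(\<lambda>n. L2.Q L (X n - \<phi>)) \<longlonglongrightarrow> 0" "\<forall>x\<in>{0..L}. (\<lambda>n. X n x) \<longlonglongrightarrow> \<phi> x"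
proof -
  interpret finite_measure "lebesgue_on {0..L}" by (rule finite_measure_lebesgue_on) auto
  have GL2: "G n \<in> L2 L" for n using X by (rule is_H1_deriv_L2)
  obtain u where u: "u \<in> sq_integrable (lebesgue_on {0..L})"
    and ulim: "(\<lambda>n. LINT x|lebesgue_on {0..L}. (cmod (G n x - u x))\<^sup>2) \<longlonglongrightarrow> 0"
  proof (rule sq_integrable_complete[of G])
    show "G n \<in> sq_integrable (lebesgue_on {0..L})" for n using GL2 by (simp add: L2_eq)
    show "\<exists>N. \<forall>i\<ge>N. \<forall>j\<ge>N. (LINT x|lebesgue_on {0..L}. (cmod (G i x - G j x))\<^sup>2) < e" if "e > 0" for e
      using Cauchy[OF that] by (auto simp: L2_Q)
  qed
  have "Cauchy (\<lambda>n. X n 0)"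
  proof (rule metric_CauchyI)
    fix e :: real assume e: "e > 0"
    define K where "K = 2 / L + 2 * L"
    have K: "K > 0" using \<open>L > 0\<close> by (simp add: K_def add_pos_pos)
    obtain M where M: "\<And>i j. i \<ge> M \<Longrightarrow> j \<ge> M \<Longrightarrow> L2.Q L (X i - X j) < e\<^sup>2 / K \<and> L2.Q L (G i - G j) < e\<^sup>2 / K"
      using Cauchy[of "e\<^sup>2 / K"] e K by auto
    have "dist (X i 0) (X j 0) < e" if "i \<ge> M" "j \<ge> M" for i j
    proof -
      have "(cmod ((X i - X j) 0))\<^sup>2 \<le> 2 / L * L2.Q L (X i - X j) + 2 * L * L2.Q L (G i - G j)"
        using \<open>L > 0\<close> by (intro H1_sup_bound is_H1_deriv_diff X) auto
      also have "\<dots> < 2 / L * (e\<^sup>2 / K) + 2 * L * (e\<^sup>2 / K)"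
        using M[OF that] \<open>L > 0\<close> by (intro add_strict_mono mult_strict_left_mono) auto
      also have "\<dots> = K * (e\<^sup>2 / K)"
      proof -
        have "2 / L * t + 2 * L * t = K * t" for t by (simp add: K_def distrib_right)
        then show ?thesis .
      qed
      also have "\<dots> = e\<^sup>2" using K by simp
      finally show ?thesis using e by (simp add: dist_norm power2_less_imp_less)
    qed
    then show "\<exists>M. \<forall>m\<ge>M. \<forall>n\<ge>M. dist (X m 0) (X n 0) < e" by blast
  qed
  then obtain c where c: "(\<lambda>n. X n 0) \<longlonglongrightarrow> c" using Cauchy_convergent convergent_def by blast
  define \<phi> where "\<phi> x = (if x \<in> {0..L} then c + (LINT t|lebesgue_on {0..x}. u t) else 0)" for x
  have \<phi>0: "\<phi> 0 = c"
  proof -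
    have "(LINT t|lebesgue_on {0..0::real}. u t) = 0"
      by (rule integral_eq_zero_null_sets) (simp add: null_sets_restrict_space)
    then show ?thesis using \<open>L > 0\<close> by (simp add: \<phi>_def)
  qed
  have \<phi>: "is_H1_deriv L \<phi> u"
    unfolding is_H1_deriv_def \<phi>0 using u by (simp add: L2_eq \<phi>_def)
  then have H1: "\<phi> \<in> H1 L" by (auto simp: H1_def \<phi>_def)
  have Glim: "(\<lambda>n. L2.Q L (G n - u)) \<longlonglongrightarrow> 0" using ulim by (simp add: L2_Q)
  \<comment> \<open>a bound for \<open>\<bar>X n - \<phi>\<bar>\<^sup>2\<close> that is uniform on the interval\<close>
  define \<delta> where "\<delta> n = 2 * (cmod (X n 0 - c))\<^sup>2 + 2 * (L * L2.Q L (G n - u))" for n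
  have \<delta>lim: "\<delta> \<longlonglongrightarrow> 0"
  proof -
    have "(\<lambda>n. 2 * (cmod (X n 0 - c))\<^sup>2 + 2 * (L * L2.Q L (G n - u))) \<longlonglongrightarrow> 2 * (cmod (c - c))\<^sup>2 + 2 * (L * 0)"
      by (intro tendsto_intros c Glim)
    then show ?thesis by (simp add: \<delta>_def[abs_def])
  qed
  have unif: "(cmod ((X n - \<phi>) x))\<^sup>2 \<le> \<delta> n" if x: "x \<in> {0..L}" for n x
  proof -
    have "(cmod ((X n - \<phi>) x - (X n - \<phi>) 0))\<^sup>2 \<le> (x - 0) * L2.Q L (G n - u)"
      using x by (intro H1_Holder is_H1_deriv_diff X \<phi>) auto
    also have "\<dots> \<le> L * L2.Q L (G n - u)" using x by (intro mult_right_mono) (auto simp: L2_Q)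
    finally show ?thesis
      using cmod_add_square_le[of "(X n - \<phi>) 0" "(X n - \<phi>) x - (X n - \<phi>) 0"]
      by (simp add: \<delta>_def \<phi>0)
  qed
  have "(\<lambda>n. X n x) \<longlonglongrightarrow> \<phi> x" if x: "x \<in> {0..L}" for x
  proof -
    have "(\<lambda>n. (cmod (X n x - \<phi> x))\<^sup>2) \<longlonglongrightarrow> 0"
      by (rule tendsto_sandwich[OF _ _ tendsto_const \<delta>lim]) (use unif[OF x] in auto)
    then have "(\<lambda>n. sqrt ((cmod (X n x - \<phi> x))\<^sup>2)) \<longlonglongrightarrow> sqrt 0" by (rule tendsto_real_sqrt)
    then show ?thesis by (simp add: tendsto_norm_zero_iff LIM_zero_iff)
  qed
  moreover have "(\<lambda>n. L2.Q L (X n - \<phi>)) \<longlonglongrightarrow> 0"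
  proof (rule tendsto_sandwich[OF _ _ tendsto_const])
    show "\<forall>\<^sub>F n in sequentially. L2.Q L (X n - \<phi>) \<le> L * \<delta> n"
      using unif \<open>L > 0\<close> H1_continuous[OF is_H1_deriv_diff[OF X \<phi>]]
      by (intro always_eventually allI L2_Q_le_sup continuous_imp_L2) auto
    show "(\<lambda>n. L * \<delta> n) \<longlonglongrightarrow> 0" using tendsto_mult[OF tendsto_const \<delta>lim, of L] by simp
  qed (simp add: L2_Q)
  ultimately show ?thesis using that[OF \<phi> H1 Glim] by blast
qed

text \<open>Parabolic bumps on the gaps between consecutive points \<open>v n\<close> vanish at all of these points. So they lie
in every form domain, and as their supports do not overlap they are orthogonal.\<close>
lemma bump_H1_deriv:
  assumes "0 \<le> a" "a < c" "c \<le> L"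
  shows "is_H1_deriv L (\<lambda>x. of_real (max 0 ((x - a) * (c - x))))
      (\<lambda>x. if x \<in> {a..c} then of_real (a + c - 2 * x) else 0)" (is "is_H1_deriv L ?b ?g")
proof -
  have meas: "?g \<in> borel_measurable (lebesgue_on {0..L})"
    by (intro measurable_If_set continuous_imp_measurable_on_sets_lebesgue continuous_intros)
      (auto simp: sets_restrict_space_iff)
  have bnd: "cmod (?g x) \<le> c" if "x \<in> {0..L}" for x
    using assms that by (auto simp: abs_if simp del: of_real_add of_real_diff of_real_mult)
  have "?g \<in> L2 L"
    unfolding L2_def
  proof (intro CollectI conjI meas)
    show "integrable (lebesgue_on {0..L}) (\<lambda>x. (cmod (?g x))\<^sup>2)"
    proof (rule finite_measure.integrable_const_bound[where B = "c\<^sup>2"])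
      show "finite_measure (lebesgue_on {0..L})" by (rule finite_measure_lebesgue_on) auto
      show "AE x in lebesgue_on {0..L}. norm ((cmod (?g x))\<^sup>2) \<le> c\<^sup>2"
      proof (rule AE_I2)
        fix x assume "x \<in> space (lebesgue_on {0..L})"
        then have "(cmod (?g x))\<^sup>2 \<le> c\<^sup>2" using bnd[of x] by (intro power_mono) auto
        then show "norm ((cmod (?g x))\<^sup>2) \<le> c\<^sup>2"
          unfolding real_norm_def abs_of_nonneg[OF zero_le_power2] .
      qed
      show "(\<lambda>x. (cmod (?g x))\<^sup>2) \<in> borel_measurable (lebesgue_on {0..L})" using meas by measurable
    qed
  qed
  moreover have "(?g has_integral ?b x - ?b 0) {0..x}" if "x \<in> {0..L}" for x
  proof (rule fundamental_theorem_of_calculus_interior_strong[of "{a, c}"])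
    show "continuous_on {0..x} ?b" by (intro continuous_intros)
    show "(?b has_vector_derivative ?g t) (at t)" if t: "t \<in> {0<..<x} - {a, c}" for t
    proof -
      consider "t \<in> {a<..<c}" | "t \<in> {..<a} \<union> {c<..}" using t by force
      then show ?thesis
      proof cases
        case 1
        have "((\<lambda>x. of_real ((x - a) * (c - x))) has_vector_derivative (of_real (a + c - 2 * t) :: complex)) (at t)"
          by (intro has_vector_derivative_of_real) (auto intro!: derivative_eq_intros simp flip: has_real_derivative_iff_has_vector_derivative)
        then have "(?b has_vector_derivative of_real (a + c - 2 * t)) (at t)"
          by (rule has_vector_derivative_transform_within_open[of _ _ _ "{a<..<c}"]) (use 1 in \<open>auto simp: max_def\<close>)
        then show ?thesis using 1 by simp
      next
        case 2
        have *: "max 0 ((y - a) * (c - y)) = 0" if "y \<in> {..<a} \<union> {c<..}" for y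
          using that assms by (auto simp: max_def mult_le_0_iff zero_le_mult_iff)
        have "((\<lambda>x. 0 :: complex) has_vector_derivative 0) (at t)" by simp
        then have "(?b has_vector_derivative 0) (at t)"
          by (rule has_vector_derivative_transform_within_open[of _ _ _ "{..<a} \<union> {c<..}"]) (use 2 * in auto)
        then show ?thesis using 2 assms by auto
      qed
    qed
  qed (use that in auto)
  moreover have "?g absolutely_integrable_on {0..L}"
  proof -
    interpret finite_measure "lebesgue_on {0..L}" by (rule finite_measure_lebesgue_on) auto
    show ?thesis using integrable_sq_integrable[of ?g] \<open>?g \<in> L2 L\<close>
      by (simp only: L2_eq integrable_lebesgue_on_iff[symmetric] sets_lebesgue_on_refl lmeasurable_cbox fmeasurableD lmeasurable_interval)
  qed
  ultimately show ?thesis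
    unfolding is_H1_deriv_iff_ac ac_def by (metis (no_types, lifting) add_diff_cancel_left' diff_add_cancel add.commute integral_unique)
qed

section \<open>Existence and uniqueness of the eigenvalue enumeration\<close>

context delta_setting
begin

text \<open>Compactness concerns the derivatives alone, since they are controlled by the form. For completeness the
$H^1$ limit must be shown to have finite energy and to be the limit in the form norm as well; both come from
bounds on the partial sums of the series that are uniform along the sequence.\<close>
sublocale form: discrete_form "\<lambda>c f x. c * f x" V "L2_inner L" dform
proof unfold_locales
  show "x = 0" if "x \<in> V" "ip.Q x = 0" for x
    using H1_definite[OF V_H1 L_pos] that by blast
next
  fix X :: "nat \<Rightarrow> real \<Rightarrow> complex" and B
  assume X: "\<And>n. X n \<in> V" and B: "\<And>n. ip.Q (X n) \<le> B" "\<And>n. h.Q (X n) \<le> B"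
  show "\<exists>r::nat\<Rightarrow>nat. strict_mono r \<and> (\<forall>\<epsilon>>0. \<exists>M. \<forall>i\<ge>M. \<forall>j\<ge>M. ip.Q (X (r i) - X (r j)) < \<epsilon>)"
  proof (rule H1_bounded_imp_Cauchy_subsequence[OF L_pos, of X "\<lambda>n. H1_deriv L (X n)" B])
    show "L2.Q L (H1_deriv L (X n)) \<le> B" for n
      using deriv_Q_le_h_Q[OF X] B(2) by (rule order_trans)
  qed (use X B V_deriv in auto)
next
  fix X :: "nat \<Rightarrow> real \<Rightarrow> complex"
  assume X: "\<And>n. X n \<in> V"
    and Cauchy: "\<And>\<epsilon>. \<epsilon> > 0 \<Longrightarrow> \<exists>M. \<forall>i\<ge>M. \<forall>j\<ge>M. ip.Q (X i - X j) < \<epsilon> \<and> h.Q (X i - X j) < \<epsilon>"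
  define G where "G n = H1_deriv L (X n)" for n
  have G: "is_H1_deriv L (X n) (G n)" for n unfolding G_def by (rule V_deriv[OF X])
  have Q_diff: "h.Q (X i - X j) = L2.Q L (G i - G j) + (\<Sum>n. \<sigma> n * (cmod ((X i - X j) (v n)))\<^sup>2)" for i j
    using h_Q[OF ip.V_intros(3)[OF X X], of i j] H1_deriv_Q[OF is_H1_deriv_diff[OF G G], of i j] by simp
  have sum_nonneg: "0 \<le> (\<Sum>n. \<sigma> n * (cmod (x (v n)))\<^sup>2)" if "x \<in> V" for x
    using suminf_nonneg[OF V_summable[OF that]] \<sigma>_nonneg by simp
  have CauchyG: "\<exists>M. \<forall>i\<ge>M. \<forall>j\<ge>M. L2.Q L (X i - X j) < \<epsilon> \<and> L2.Q L (G i - G j) < \<epsilon>" if "\<epsilon> > 0" for \<epsilon>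
  proof -
    from Cauchy[OF that] obtain M where M: "\<And>i j. i \<ge> M \<Longrightarrow> j \<ge> M \<Longrightarrow> ip.Q (X i - X j) < \<epsilon> \<and> h.Q (X i - X j) < \<epsilon>"
      by blast
    have "L2.Q L (G i - G j) \<le> h.Q (X i - X j)" for i j
      using sum_nonneg[OF ip.V_intros(3)[OF X X], of i j] unfolding Q_diff by simp
    then show ?thesis using M by (meson le_less_trans)
  qed
  obtain \<phi> u where \<phi>: "is_H1_deriv L \<phi> u" "\<phi> \<in> H1 L" and Glim: "(\<lambda>n. L2.Q L (G n - u)) \<longlonglongrightarrow> 0"
    and Xlim: "(\<lambda>n. L2.Q L (X n - \<phi>)) \<longlonglongrightarrow> 0" and ptw: "\<forall>x\<in>{0..L}. (\<lambda>n. X n x) \<longlonglongrightarrow> \<phi> x"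
    by (rule H1_complete[OF L_pos G CauchyG])
  have vI: "v n \<in> {0..L}" for n using v_range[of n] by auto
  \<comment> \<open>the series part of the form is lower semicontinuous: pass to the limit in partial sums\<close>
  have tail: "summable (\<lambda>n. \<sigma> n * (cmod ((X i - \<phi>) (v n)))\<^sup>2)"
    "(\<Sum>n. \<sigma> n * (cmod ((X i - \<phi>) (v n)))\<^sup>2) \<le> \<epsilon>"
    if M: "\<And>j. j \<ge> M \<Longrightarrow> h.Q (X i - X j) < \<epsilon>" for i M \<epsilon>
  proof -
    have partial: "(\<Sum>n<k. \<sigma> n * (cmod ((X i - \<phi>) (v n)))\<^sup>2) \<le> \<epsilon>" for k
    proof (rule LIMSEQ_le_const2)
      show "(\<lambda>j. \<Sum>n<k. \<sigma> n * (cmod ((X i - X j) (v n)))\<^sup>2) \<longlonglongrightarrow> (\<Sum>n<k. \<sigma> n * (cmod ((X i - \<phi>) (v n)))\<^sup>2)"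
        unfolding fun_diff_def by (intro tendsto_intros ptw[rule_format] vI)
      show "\<exists>N. \<forall>j\<ge>N. (\<Sum>n<k. \<sigma> n * (cmod ((X i - X j) (v n)))\<^sup>2) \<le> \<epsilon>"
      proof (intro exI allI impI)
        fix j assume "j \<ge> M"
        have "(\<Sum>n<k. \<sigma> n * (cmod ((X i - X j) (v n)))\<^sup>2) \<le> (\<Sum>n. \<sigma> n * (cmod ((X i - X j) (v n)))\<^sup>2)"
          using \<sigma>_nonneg by (intro sum_le_suminf V_summable ip.V_intros X) auto
        also have "\<dots> \<le> h.Q (X i - X j)" unfolding Q_diff by (simp add: L2_Q)
        finally show "(\<Sum>n<k. \<sigma> n * (cmod ((X i - X j) (v n)))\<^sup>2) \<le> \<epsilon>" using M[OF \<open>j \<ge> M\<close>] by simp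
      qed
    qed
    show s: "summable (\<lambda>n. \<sigma> n * (cmod ((X i - \<phi>) (v n)))\<^sup>2)"
      using partial \<sigma>_nonneg by (intro summableI_nonneg_bounded[of _ \<epsilon>]) auto
    show "(\<Sum>n. \<sigma> n * (cmod ((X i - \<phi>) (v n)))\<^sup>2) \<le> \<epsilon>"
      using s partial by (rule suminf_le_const)
  qed
  have "\<phi> \<in> V"
  proof -
    obtain M where "\<And>i j. i \<ge> M \<Longrightarrow> j \<ge> M \<Longrightarrow> h.Q (X i - X j) < 1" using Cauchy[of 1] by auto
    then have "summable (\<lambda>n. \<sigma> n * (cmod ((X M - \<phi>) (v n)))\<^sup>2)" by (intro tail(1)[of M M 1]) simp
    moreover have "X M - \<phi> \<in> H1 L" using cfun.subspace_diff[OF subspace_H1 V_H1[OF X] \<phi>(2)] .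
    ultimately have "X M - \<phi> \<in> V" by (simp add: form_domain_def)
    from ip.V_intros(3)[OF X[of M] this] show ?thesis by (simp add: fun_diff_def)
  qed
  moreover have "(\<lambda>n. h.Q (X n - \<phi>)) \<longlonglongrightarrow> 0"
  proof (rule LIMSEQ_I)
    fix e :: real assume e: "e > 0"
    obtain M where M: "\<And>i j. i \<ge> M \<Longrightarrow> j \<ge> M \<Longrightarrow> h.Q (X i - X j) < e / 2" using Cauchy[of "e / 2"] e by auto
    obtain M' where M': "\<And>i. i \<ge> M' \<Longrightarrow> norm (L2.Q L (G i - u) - 0) < e / 2"
      using LIMSEQ_D[OF Glim, of "e / 2"] e by auto
    have "norm (h.Q (X i - \<phi>) - 0) < e" if "i \<ge> max M M'" for i
    proof -
      have "h.Q (X i - \<phi>) = L2.Q L (G i - u) + (\<Sum>n. \<sigma> n * (cmod ((X i - \<phi>) (v n)))\<^sup>2)"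
        using h_Q[OF ip.V_intros(3)[OF X \<open>\<phi> \<in> V\<close>], of i] H1_deriv_Q[OF is_H1_deriv_diff[OF G \<phi>(1)], of i] by simp
      moreover have "(\<Sum>n. \<sigma> n * (cmod ((X i - \<phi>) (v n)))\<^sup>2) \<le> e / 2"
        using M that by (intro tail(2)[of M]) auto
      moreover have "0 \<le> h.Q (X i - \<phi>)" using X \<open>\<phi> \<in> V\<close> by (intro h.Q_nonneg ip.V_intros)
      ultimately show ?thesis using M'[of i] that by auto
    qed
    then show "\<exists>N. \<forall>i\<ge>N. norm (h.Q (X i - \<phi>) - 0) < e" by blast
  qed
  ultimately show "\<exists>x\<in>V. (\<lambda>n. ip.Q (X n - x)) \<longlonglongrightarrow> 0 \<and> (\<lambda>n. h.Q (X n - x)) \<longlonglongrightarrow> 0"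
    using Xlim by blast
next
  \<comment> \<open>truncation by \<open>max 0\<close> confines the parabola to the gap between \<open>v n\<close> and \<open>v (Suc n)\<close>\<close>
  define b :: "nat \<Rightarrow> real \<Rightarrow> complex" where "b n x = of_real (max 0 ((x - v n) * (v (Suc n) - x)))" for n x
  have v0: "0 \<le> v n" "v n < v (Suc n)" "v (Suc n) \<le> L" for n
    using v_range[of n] v_range[of "Suc n"] v_mono by (auto simp: strict_mono_Suc_iff)
  have v_le: "m \<le> n \<Longrightarrow> v m \<le> v n" for m n using v_mono by (simp add: strict_mono_less_eq)
  have supp: "b n x = 0 \<longleftrightarrow> \<not> (v n < x \<and> x < v (Suc n))" for n x
  proof -
    have "(x - v n) * (v (Suc n) - x) \<le> 0 \<longleftrightarrow> \<not> (v n < x \<and> x < v (Suc n))"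
      using v0(2)[of n] by (auto simp: mult_le_0_iff)
    then show ?thesis by (auto simp: b_def max_def)
  qed
  have b_v: "b n (v k) = 0" for n k
    using v_le[of k n] v_le[of "Suc n" k] unfolding supp by (cases "k \<le> n") auto
  have "b n \<in> V" for n
  proof -
    have "b n x = 0" if "x \<notin> {0..L}" for x using that v0[of n] by (auto simp: supp)
    moreover have "\<exists>g. is_H1_deriv L (b n) g" unfolding b_def using bump_H1_deriv[OF v0] by blast
    ultimately show ?thesis by (simp add: form_domain_def H1_def b_v)
  qed
  moreover have "b n \<noteq> 0" for n
  proof
    assume "b n = 0"
    moreover obtain x where "v n < x" "x < v (Suc n)" using dense[OF v0(2)] by blast
    ultimately show False using supp[of n x] by simp
  qed
  moreover have "L2_inner L (b m) (b n) = 0" if "m \<noteq> n" for m n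
  proof -
    have "b m x = 0 \<or> b n x = 0" for x
      using that v_le[of "Suc m" n] v_le[of "Suc n" m] unfolding supp by (cases "m < n") auto
    then have "(\<lambda>x. b m x * cnj (b n x)) = (\<lambda>x. 0)" by auto
    then show ?thesis by (simp add: L2_inner_def)
  qed
  ultimately show "\<exists>b::nat \<Rightarrow> real \<Rightarrow> complex. (\<forall>n. b n \<in> V \<and> b n \<noteq> 0) \<and> (\<forall>m n. m \<noteq> n \<longrightarrow> L2_inner L (b m) (b n) = 0)"
    by blast
qed

lemma eigenspace_eq_eigen: "eigenspace L v \<sigma> \<mu> = form.eigen \<mu>"
proof -
  have "(\<lambda>x. of_real \<mu> * \<phi> x) \<in> L2 L" if "\<phi> \<in> V" for \<phi>
    using V_L2[OF that] by (rule L2.V_intros)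
  moreover have "L2_inner L (\<lambda>x. of_real \<mu> * \<phi> x) \<psi> = of_real \<mu> * L2_inner L \<phi> \<psi>"
    if "\<phi> \<in> V" "\<psi> \<in> V" for \<phi> \<psi>
    using that by (intro L2.scale_left V_L2)
  ultimately show ?thesis
    unfolding eigenspace_def form.eigen_def delta_op_def by auto
qed

lemma delta_eigenvalue_eq:
  assumes "form.eigenvalue_sequence lam"
  shows "delta_eigenvalue L v \<sigma> = lam"
proof -
  have iff: "eigenvalue_enumeration L v \<sigma> lam' \<longleftrightarrow> form.eigenvalue_sequence lam'" for lam'
    unfolding eigenvalue_enumeration_def form.eigenvalue_sequence_def eigenspace_eq_eigen ..
  show ?thesis
    unfolding delta_eigenvalue_def iff
  proof (rule the_equality)
    show "form.eigenvalue_sequence lam" by fact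
    fix lam' assume lam': "form.eigenvalue_sequence lam'"
    show "lam' = lam"
    proof (rule mono_sequence_determined_by_multiplicities)
      show "card {n. lam' n = t} = card {n. lam n = t}" for t
        using lam' assms unfolding form.eigenvalue_sequence_def by metis
    qed (use lam' assms in \<open>auto simp: form.eigenvalue_sequence_def\<close>)
  qed
qed

end

section \<open>The Neumann eigenvalues\<close>

lemma L2_inner_eq_integral:
  assumes "f \<in> L2 L" "g \<in> L2 L"
  shows "L2_inner L f g = integral {0..L} (\<lambda>x. f x * cnj (g x))"
  unfolding L2_inner_def
  by (rule lebesgue_integral_eq_integral) (use assms integrable_mult_cnj in \<open>auto simp: L2_eq\<close>)

lemma is_H1_deriv_truncate:
  assumes "is_H1_deriv L \<phi> g" "L > 0"
  shows "is_H1_deriv L (\<lambda>x. if x \<in> {0..L} then \<phi> x else 0) g"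
  unfolding is_H1_deriv_def
proof (intro conjI ballI)
  show "g \<in> L2 L" using assms(1) by (rule is_H1_deriv_L2)
  fix x assume x: "x \<in> {0..L}"
  have "\<phi> x = \<phi> 0 + (LINT t|lebesgue_on {0..x}. g t)"
    using assms(1) x unfolding is_H1_deriv_def by blast
  then show "(if x \<in> {0..L} then \<phi> x else 0)
      = (if 0 \<in> {0..L} then \<phi> 0 else 0) + (LINT t|lebesgue_on {0..x}. g t)"
    using x \<open>L > 0\<close> by simp
qed

text \<open>The Neumann eigenfunctions. Integration by parts produces no boundary terms, since
\<open>sin (\<kappa> * x)\<close> vanishes at both end points.\<close>
lemma cos_is_eigenfunction:
  fixes k :: nat
  assumes "L > 0"
  defines "\<kappa> \<equiv> real k * pi / L"
  defines "c \<equiv> \<lambda>x. if x \<in> {0..L} then of_real (cos (\<kappa> * x)) else 0"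
  shows "c \<in> H1 L" "c \<noteq> 0"
    and "\<And>\<psi>. \<psi> \<in> H1 L \<Longrightarrow> L2_inner L (H1_deriv L c) (H1_deriv L \<psi>) = of_real (\<kappa>\<^sup>2) * L2_inner L c \<psi>"
proof -
  define C :: "real \<Rightarrow> complex" where "C x = of_real (cos (\<kappa> * x))" for x
  define S :: "real \<Rightarrow> complex" where "S x = of_real (- \<kappa> * sin (\<kappa> * x))" for x
  have acC: "ac 0 L C S"
    unfolding C_def S_def using \<open>L > 0\<close>
    by (intro ac_smooth has_vector_derivative_of_real)
       (auto intro!: derivative_eq_intros continuous_intros simp flip: has_real_derivative_iff_has_vector_derivative)
  have acS: "ac 0 L S (\<lambda>x. - of_real (\<kappa>\<^sup>2) * C x)"
  proof -
    have "ac 0 L S (\<lambda>x. of_real (- \<kappa> * (\<kappa> * cos (\<kappa> * x))))"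
      unfolding S_def using \<open>L > 0\<close>
      by (intro ac_smooth has_vector_derivative_of_real)
         (auto intro!: derivative_eq_intros continuous_intros simp flip: has_real_derivative_iff_has_vector_derivative)
    moreover have "(\<lambda>x. of_real (- \<kappa> * (\<kappa> * cos (\<kappa> * x)))) = (\<lambda>x. - of_real (\<kappa>\<^sup>2) * C x)"
      by (simp add: C_def power2_eq_square mult.assoc)
    ultimately show ?thesis by simp
  qed
  have S_L2: "S \<in> L2 L" using acS by (intro continuous_imp_L2 ac_continuous)
  have "is_H1_deriv L C S" using acC S_L2 by (simp add: is_H1_deriv_iff_ac)
  then have c: "is_H1_deriv L c S" unfolding c_def C_def using \<open>L > 0\<close> by (rule is_H1_deriv_truncate)
  then show cH: "c \<in> H1 L" by (auto simp: H1_def c_def)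
  have "c 0 = 1" using \<open>L > 0\<close> by (simp add: c_def)
  then show "c \<noteq> 0" by (metis zero_fun_apply zero_neq_one)
  fix \<psi> assume "\<psi> \<in> H1 L"
  then obtain g where g: "is_H1_deriv L \<psi> g" by (rule H1_derivE)
  then have ac\<psi>: "ac 0 L \<psi> g" and gL2: "g \<in> L2 L" by (simp_all add: is_H1_deriv_iff_ac)
  have \<psi>L2: "\<psi> \<in> L2 L" using H1_imp_L2 \<open>\<psi> \<in> H1 L\<close> .
  have CL2: "C \<in> L2 L" using acC by (intro continuous_imp_L2 ac_continuous)
  have iSg: "(\<lambda>x. S x * cnj (g x)) integrable_on {0..L}"
    using integrable_mult_cnj[of S "lebesgue_on {0..L}" g] S_L2 gL2
    by (intro integrable_on_lebesgue_on) (auto simp: L2_eq)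
  have iC: "(\<lambda>x. C x * cnj (\<psi> x)) integrable_on {0..L}"
    using integrable_mult_cnj[of C "lebesgue_on {0..L}" \<psi>] CL2 \<psi>L2
    by (intro integrable_on_lebesgue_on) (auto simp: L2_eq)
  have "S L = 0" "S 0 = 0" using \<open>L > 0\<close> by (simp_all add: S_def \<kappa>_def)
  then have "0 = integral {0..L} (\<lambda>x. - of_real (\<kappa>\<^sup>2) * C x * cnj (\<psi> x) + S x * cnj (g x))"
    using ac_integration_by_parts[OF acS ac_cnj[OF ac\<psi>]] \<open>L > 0\<close> by simp
  also have "\<dots> = - of_real (\<kappa>\<^sup>2) * integral {0..L} (\<lambda>x. C x * cnj (\<psi> x)) + integral {0..L} (\<lambda>x. S x * cnj (g x))"
    using iSg integrable_on_mult_right[OF iC, of "- of_real (\<kappa>\<^sup>2)"]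
    by (subst Henstock_Kurzweil_Integration.integral_add) (simp_all add: mult.assoc del: of_real_power)
  finally have "L2_inner L S g = of_real (\<kappa>\<^sup>2) * L2_inner L C \<psi>"
    using L2_inner_eq_integral[OF S_L2 gL2] L2_inner_eq_integral[OF CL2 \<psi>L2] by simp
  moreover have "L2_inner L C \<psi> = L2_inner L c \<psi>"
    unfolding L2_inner_def by (rule Bochner_Integration.integral_cong) (auto simp: c_def C_def)
  ultimately show "L2_inner L (H1_deriv L c) (H1_deriv L \<psi>) = of_real (\<kappa>\<^sup>2) * L2_inner L c \<psi>"
    by (simp add: L2_inner_H1_deriv[OF c g])
qed

text \<open>The numbers \<open>(k * pi / L)\<^sup>2\<close> are eigenvalues and strictly increasing in \<open>k\<close>, so the \<open>k\<close>-th of them appears in the enumeration of all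
eigenvalues at position \<open>k\<close> or later.\<close>
lemma Neumann_eigenvalue_le:
  assumes "delta_setting L v (\<lambda>_. 0)"
  shows "delta_eigenvalue L v (\<lambda>_. 0) n \<le> (real n * pi / L)\<^sup>2"
proof -
  interpret delta_setting L v "\<lambda>_. 0" by fact
  obtain e lam where basis: "form.eigenbasis e lam" and lam: "form.eigenvalue_sequence lam"
    by (rule form.exists_eigenbasis)
  have eig: "form.eigen \<mu> = cfun.span (e ` {n. lam n = \<mu>})" for \<mu>
    using basis by (simp add: form.eigenbasis_def)
  define \<mu> where "\<mu> k = (real k * pi / L)\<^sup>2" for k :: nat
  have "\<exists>m. lam m = \<mu> k" for k
  proof -
    define c :: "real \<Rightarrow> complex" where "c = (\<lambda>x. if x \<in> {0..L} then of_real (cos (real k * pi / L * x)) else 0)"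
    have "c \<in> V" using cos_is_eigenfunction(1)[OF L_pos, of k] by (simp add: form_domain_def c_def)
    moreover have "dform c \<psi> = of_real (\<mu> k) * L2_inner L c \<psi>" if "\<psi> \<in> V" for \<psi>
      using cos_is_eigenfunction(3)[OF L_pos V_H1[OF that], of k]
      by (simp add: delta_form_def c_def \<mu>_def del: of_real_power)
    ultimately have "c \<in> form.eigen (\<mu> k)" by (simp add: form.eigen_def)
    moreover have "c \<noteq> 0" unfolding c_def by (rule cos_is_eigenfunction(2)[OF L_pos])
    ultimately have "{n. lam n = \<mu> k} \<noteq> {}" unfolding eig by (auto simp: cfun.span_empty)
    then show ?thesis by auto
  qed
  then obtain m where m: "\<And>k. lam (m k) = \<mu> k" by metis
  have mono: "mono lam" using lam by (simp add: form.eigenvalue_sequence_def)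
  \<comment> \<open>positions of distinct eigenvalues in a monotone enumeration are ordered like the eigenvalues\<close>
  have "strict_mono m"
  proof (rule strict_mono_Suc_iff[THEN iffD2], intro allI)
    fix k
    have "real k * pi / L < real (Suc k) * pi / L" using L_pos by (simp add: divide_strict_right_mono)
    then have "\<mu> k < \<mu> (Suc k)" unfolding \<mu>_def using L_pos by (intro power_strict_mono) auto
    then show "m k < m (Suc k)" using m monoD[OF mono, of "m (Suc k)" "m k"] by (metis leD leI)
  qed
  then have "lam n \<le> lam (m n)" by (intro monoD[OF mono] seq_suble)
  then show ?thesis by (simp add: delta_eigenvalue_eq[OF lam] m \<mu>_def)
qed

section \<open>The lower bound for non-summable strengths\<close>

text \<open>The prescribed zeros are those of the mixed eigenfunction \<open>cos ((n + 1 / 2) * pi * x / L)\<close>. They cut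
$[0,L]$ into pieces for which \<open>((n + 1 / 2) * pi / L)\<^sup>2\<close> is exactly the lowest eigenvalue: \<open>n\<close> intervals
of length \<open>2 * L / (2 * n + 1)\<close> with Dirichlet conditions, and at 0 one of half that length
with a Neumann condition at its left end.\<close>
lemma Wirtinger_equidistant_zeros:
  fixes n :: nat
  assumes H: "is_H1_deriv L \<phi> g" and "L > 0"
    and zero: "\<And>j. j \<le> n \<Longrightarrow> \<phi> (L * (2 * real j + 1) / (2 * real n + 1)) = 0"
    and s: "0 \<le> s" "s < (real n + 1 / 2) * pi / L"
  shows "s\<^sup>2 * L2.Q L \<phi> \<le> L2.Q L g"
proof -
  define x where "x j = L * (2 * real j + 1) / (2 * real n + 1)" for j :: nat
  \<comment> \<open>half the distance between neighbouring zeros, and the distance of the first zero from 0\<close>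
  define \<delta> where "\<delta> = L / (2 * real n + 1)"
  have \<delta>: "\<delta> > 0" using \<open>L > 0\<close> by (simp add: \<delta>_def)
  have x: "x j = (2 * real j + 1) * \<delta>" for j by (simp add: x_def \<delta>_def)
  have s\<delta>: "s * \<delta> < pi / 2"
  proof -
    have "s * \<delta> < (real n + 1 / 2) * pi / L * \<delta>" using s \<delta> by (intro mult_strict_right_mono) auto
    also have "\<dots> = pi / 2"
    proof -
      have "real n + 1 / 2 = (2 * real n + 1) / 2" by simp
      then have "(real n + 1 / 2) * pi / L * \<delta> = (2 * real n + 1) / 2 * pi / L * (L / (2 * real n + 1))"
        by (simp only: \<delta>_def)
      also have "\<dots> = pi / 2" using \<open>L > 0\<close> by (simp add: divide_simps)
      finally show ?thesis .
    qed
    finally show ?thesis .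
  qed
  have small: "\<bar>s * (t - m)\<bar> < pi / 2" if "\<bar>t - m\<bar> \<le> \<delta>" for t m
    using mult_left_mono[OF that s(1)] s\<delta> s(1) by (simp add: abs_mult)
  have xn: "x n = L" using \<open>L > 0\<close> by (simp add: x_def)
  have xL: "x j \<le> L" if "j \<le> n" for j
  proof -
    have "x j \<le> x n" unfolding x using that \<delta> by (intro mult_right_mono) auto
    then show ?thesis by (simp add: xn)
  qed
  have ac: "ac 0 L \<phi> g" and gL2: "g \<in> L2 L" using H by (simp_all add: is_H1_deriv_iff_ac)
  have \<phi>L2: "\<phi> \<in> L2 L" using H by (intro continuous_imp_L2 H1_continuous)
  note ig = L2_norm_square_integrable(1)[OF gL2] and i\<phi> = L2_norm_square_integrable(1)[OF \<phi>L2]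
  have "s\<^sup>2 * integral {0..x k} (\<lambda>t. (cmod (\<phi> t))\<^sup>2) \<le> integral {0..x k} (\<lambda>t. (cmod (g t))\<^sup>2)" if "k \<le> n" for k
    using that
  proof (induction k)
    case 0
    show ?case
    proof (rule Wirtinger_tan[where m = 0])
      show "ac 0 (x 0) \<phi> g" using ac \<delta> xL[of 0] by (intro ac_subinterval[OF ac]) (auto simp: x)
      show "(\<lambda>t. (cmod (g t))\<^sup>2) integrable_on {0..x 0}" using xL[of 0] by (intro ig) auto
      show "\<phi> (x 0) = 0" using zero[of 0] by (simp add: x_def)
      show "\<bar>s * (t - 0)\<bar> < pi / 2" if "t \<in> {0..x 0}" for t
        using that by (intro small) (auto simp: x)
    qed (use \<delta> in \<open>auto simp: x\<close>)
  next
    case (Suc k)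
    have x0: "0 \<le> x k" "x k \<le> x (Suc k)" "x (Suc k) \<le> L"
      using \<delta> xL[OF Suc.prems] by (auto simp: x mult_right_mono)
    have piece: "s\<^sup>2 * integral {x k..x (Suc k)} (\<lambda>t. (cmod (\<phi> t))\<^sup>2) \<le> integral {x k..x (Suc k)} (\<lambda>t. (cmod (g t))\<^sup>2)"
    proof (rule Wirtinger_tan[where m = "x k + \<delta>"])
      show "ac (x k) (x (Suc k)) \<phi> g" using x0 by (intro ac_subinterval[OF ac])
      show "(\<lambda>t. (cmod (g t))\<^sup>2) integrable_on {x k..x (Suc k)}" using x0 by (intro ig)
      show "\<phi> (x (Suc k)) = 0" using zero[OF Suc.prems] by (simp only: x_def)
      show "\<phi> (x k) = 0 \<or> x k = x k + \<delta>" using zero[of k] Suc.prems by (simp add: x_def)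
      show "\<bar>s * (t - (x k + \<delta>))\<bar> < pi / 2" if "t \<in> {x k..x (Suc k)}" for t
        using that by (intro small) (auto simp: x algebra_simps)
    qed fact
    have "integral {0..x (Suc k)} f = integral {0..x k} f + integral {x k..x (Suc k)} f"
      if "f integrable_on {0..x (Suc k)}" for f :: "real \<Rightarrow> real"
      using Henstock_Kurzweil_Integration.integral_combine[OF x0(1,2) that] by simp
    then show ?case
      using Suc.IH Suc.prems piece ig[of 0 "x (Suc k)"] i\<phi>[of 0 "x (Suc k)"] x0 by (simp add: distrib_left)
  qed
  from this[OF order_refl] show ?thesis
    using L2_norm_square_integrable(3)[OF gL2, of 0 L] L2_norm_square_integrable(3)[OF \<phi>L2, of 0 L]
    by (simp add: xn)
qed

text \<open>If \<open>\<phi> L \<noteq> 0\<close>, then \<open>\<bar>\<phi> (v n)\<bar>\<^sup>2\<close> is bounded below for large \<open>n\<close> because \<open>v n\<close> tends to \<open>L\<close>, and so the energy of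
\<open>\<phi>\<close> dominates a multiple of the divergent series of the \<open>\<sigma> n\<close>.\<close>
lemma nonsummable_imp_Dirichlet:
  assumes setting: "delta_setting L v \<sigma>" and lim: "v \<longlonglongrightarrow> L" and "\<not> summable \<sigma>" and \<phi>: "\<phi> \<in> form_domain L v \<sigma>"
  shows "\<phi> L = 0"
proof (rule ccontr)
  assume nz: "\<phi> L \<noteq> 0"
  interpret delta_setting L v \<sigma> by fact
  have cont: "continuous_on {0..L} \<phi>" using V_deriv[OF \<phi>] by (rule H1_continuous)
  have "(\<lambda>n. \<phi> (v n)) \<longlonglongrightarrow> \<phi> L"
  proof (rule continuous_on_tendsto_compose[OF cont lim])
    show "L \<in> {0..L}" using L_pos by simp
    show "\<forall>\<^sub>F n in sequentially. v n \<in> {0..L}" using v_range by (intro always_eventually allI) (auto intro: less_imp_le)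
  qed
  then have "(\<lambda>n. (cmod (\<phi> (v n)))\<^sup>2) \<longlonglongrightarrow> (cmod (\<phi> L))\<^sup>2" by (intro tendsto_intros)
  moreover have "(cmod (\<phi> L))\<^sup>2 / 2 < (cmod (\<phi> L))\<^sup>2" using nz by simp
  ultimately have "\<forall>\<^sub>F n in sequentially. (cmod (\<phi> L))\<^sup>2 / 2 < (cmod (\<phi> (v n)))\<^sup>2"
    by (rule order_tendstoD)
  then have ev: "\<forall>\<^sub>F n in sequentially. norm (\<sigma> n) \<le> 2 / (cmod (\<phi> L))\<^sup>2 * (\<sigma> n * (cmod (\<phi> (v n)))\<^sup>2)"
  proof eventually_elim
    case (elim n)
    have "\<sigma> n * ((cmod (\<phi> L))\<^sup>2 / 2) \<le> \<sigma> n * (cmod (\<phi> (v n)))\<^sup>2"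
      using elim \<sigma>_nonneg[of n] by (intro mult_left_mono) auto
    then show ?case using nz \<sigma>_nonneg[of n] by (simp add: field_simps)
  qed
  have "summable \<sigma>"
    by (rule summable_comparison_test_ev[OF ev]) (intro summable_mult V_summable \<phi>)
  with \<open>\<not> summable \<sigma>\<close> show False ..
qed

lemma sum_fun_apply: "(\<Sum>i\<in>A. f i) x = (\<Sum>i\<in>A. f i x)"
  by (induction A rule: infinite_finite_induct) auto

text \<open>A combination of the first \<open>n + 1\<close> eigenfunctions can be made to vanish at the \<open>n\<close> interior
zeros of the comparison cosine. The Dirichlet condition provides the last zero, at \<open>L\<close>, and
Wirtinger's inequality bounds the energy of the combination from below. The side conditions are
zeros rather than orthogonality relations, because zeros decouple the problem into intervals on
which the inequality is elementary.\<close>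
lemma nonsummable_eigenvalue_ge:
  assumes setting: "delta_setting L v \<sigma>" and lim: "v \<longlonglongrightarrow> L" and nonsum: "\<not> summable \<sigma>"
  shows "((real n + 1 / 2) * pi / L)\<^sup>2 \<le> delta_eigenvalue L v \<sigma> n"
proof -
  interpret delta_setting L v \<sigma> by fact
  obtain e lam where basis: "form.eigenbasis e lam" and lam: "form.eigenvalue_sequence lam"
    by (rule form.exists_eigenbasis)
  define x where "x j = L * (2 * real j + 1) / (2 * real n + 1)" for j :: nat
  obtain \<phi> where \<phi>: "\<phi> \<in> V" "\<phi> \<noteq> 0" "\<And>j. j < n \<Longrightarrow> \<phi> (x j) = 0" "h.Q \<phi> \<le> lam n * ip.Q \<phi>"
    by (rule form.low_energy_vector_in_kernel[OF basis, of "\<lambda>j \<phi>. \<phi> (x j)" n])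
       (auto simp: sum_fun_apply)
  have zero: "\<phi> (x j) = 0" if "j \<le> n" for j
  proof (cases "j = n")
    case True
    then show ?thesis using nonsummable_imp_Dirichlet[OF setting lim nonsum \<phi>(1)] L_pos by (simp add: x_def)
  qed (use that \<phi>(3) in simp)
  have pos: "ip.Q \<phi> > 0" using form.Q_pos \<phi> by blast
  define s0 where "s0 = (real n + 1 / 2) * pi / L"
  have s0: "s0 > 0" using L_pos by (simp add: s0_def)
  \<comment> \<open>Wirtinger's inequality is available only below the critical frequency \<open>s0\<close>, which is then approached\<close>
  have le: "s\<^sup>2 \<le> lam n" if "0 \<le> s" "s < s0" for s
  proof -
    have "s\<^sup>2 * ip.Q \<phi> \<le> L2.Q L (H1_deriv L \<phi>)"
      by (rule Wirtinger_equidistant_zeros[OF V_deriv[OF \<phi>(1)] L_pos, of n]) (use zero that in \<open>auto simp: x_def s0_def\<close>)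
    also have "\<dots> \<le> h.Q \<phi>" using \<phi>(1) by (rule deriv_Q_le_h_Q)
    finally have "s\<^sup>2 * ip.Q \<phi> \<le> lam n * ip.Q \<phi>" using \<phi>(4) by simp
    then show ?thesis using pos by simp
  qed
  have "s0\<^sup>2 \<le> lam n"
  proof (rule ccontr)
    assume "\<not> s0\<^sup>2 \<le> lam n"
    moreover have "0 \<le> lam n" using le[of 0] s0 by simp
    ultimately have "sqrt (lam n) < s0" using s0 by (simp add: real_less_lsqrt)
    then obtain s where s: "sqrt (lam n) < s" "s < s0" using dense by blast
    moreover have "0 \<le> s" using s(1) real_sqrt_ge_zero[OF \<open>0 \<le> lam n\<close>] by linarith
    ultimately have "s\<^sup>2 \<le> lam n" by (intro le) auto
    then have "s \<le> sqrt (lam n)" by (rule real_le_rsqrt)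
    with s show False by simp
  qed
  then show ?thesis by (simp add: s0_def delta_eigenvalue_eq[OF lam])
qed

section \<open>Divergence of the Cesaro means\<close>

theorem theorem6:
  fixes L :: real and v \<sigma> :: "nat \<Rightarrow> real"
  assumes "L > 0"
    and "strict_mono v" and "v 0 = 0" and "\<And>n. v n \<in> {0..<L}"
    and "(\<lambda>n. v (Suc n) - v n) sums L"
    and "\<And>n. \<sigma> n \<ge> 0" and "\<not> summable \<sigma>"
  shows "filterlim
           (\<lambda>N. (\<Sum>n<N. delta_eigenvalue L v \<sigma> n - delta_eigenvalue L v (\<lambda>_. 0) n) / real N)
           at_top sequentially"
proof -
  have setting: "delta_setting L v \<sigma>" "delta_setting L v (\<lambda>_. 0)"
    using assms by (auto simp: delta_setting_def)
  have lim: "v \<longlonglongrightarrow> L"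
    using assms(3,5) by (simp add: sums_def sum_lessThan_telescope)
  define K where "K = pi\<^sup>2 / L\<^sup>2"
  have K: "K > 0" using \<open>L > 0\<close> by (simp add: K_def)
  have gap: "K * real n \<le> delta_eigenvalue L v \<sigma> n - delta_eigenvalue L v (\<lambda>_. 0) n" for n
  proof -
    have square: "(t * pi / L)\<^sup>2 = K * t\<^sup>2" for t
      by (simp add: K_def power_mult_distrib power_divide)
    have "K * real n \<le> K * ((real n + 1 / 2)\<^sup>2 - (real n)\<^sup>2)"
      using K by (intro mult_left_mono) (auto simp: power2_sum)
    also have "\<dots> = ((real n + 1 / 2) * pi / L)\<^sup>2 - (real n * pi / L)\<^sup>2"
      by (simp add: square right_diff_distrib)
    finally show ?thesis
      using nonsummable_eigenvalue_ge[OF setting(1) lim assms(7), of n] Neumann_eigenvalue_le[OF setting(2), of n]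
      by linarith
  qed
  have sum_ge: "K / 2 * (real N - 1) \<le> (\<Sum>n<N. delta_eigenvalue L v \<sigma> n - delta_eigenvalue L v (\<lambda>_. 0) n) / real N"
    if "N > 0" for N
  proof -
    have "K / 2 * (real N - 1) * real N = (\<Sum>n<N. K * real n)"
      by (induction N) (simp_all add: algebra_simps)
    also have "\<dots> \<le> (\<Sum>n<N. delta_eigenvalue L v \<sigma> n - delta_eigenvalue L v (\<lambda>_. 0) n)"
      by (intro sum_mono gap)
    finally show ?thesis using that by (simp add: pos_le_divide_eq)
  qed
  have "filterlim (\<lambda>N. K / 2 * (real N - 1)) at_top sequentially"
  proof (rule filterlim_tendsto_pos_mult_at_top[OF tendsto_const])
    show "filterlim (\<lambda>N. real N - 1) at_top sequentially"
      using filterlim_tendsto_add_at_top[OF tendsto_const[of "-1"] filterlim_real_sequentially] by simp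
  qed (use K in simp)
  then show ?thesis
    by (rule filterlim_at_top_mono) (use sum_ge in \<open>auto simp: eventually_sequentially intro!: exI[of _ 1]\<close>)
qed

end
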